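(* The maps $\pi:\mathfrak A\to\mathfrak B$ and $\Gamma:S_*(\mathfrak A)\to S_*(\mathfrak B)$ embed the abelian system in the non-abelian one consistently with the dynamics, in the following sense. (i) $\pi$ is an injective, isometric $^*$-homomorphism and $\mathcal U^t\circ\pi=\pi\circ U^t$ on $\mathfrak A$ for every $t\in\mathbb R$. (ii) For every $f\in\mathfrak A$ and every probability density $p\in\mathfrak A_*$, $\omega_p f=\Gamma(\omega_p)(\pi f)$. (iii) $\mathcal P^t\circ\Gamma=\Gamma\circ P^t$ on $S_*(\mathfrak A)$ for every $t\in\mathbb R$.
   Context: Let $\Phi^t:X\to X$, $t\in\mathbb R$, be a (measurable) dynamical flow on a completely metrizable, separable space $X$ with an ergodic, invariant, Borel probability measure $\mu$. Put $H=L^2(X,\mu)$, $\langle f,g\rangle=\int_X f^*g\,d\mu$; $\mathfrak A=L^\infty(X,\mu)$ (abelian von Neumann algebra under pointwise multiplication and complex conjugation) with predual $\mathfrak A_*=L^1(X,\mu)$; $\mathfrak B=B(H)$ (bounded operators) with predual $\mathfrak B_*=B_1(H)$ (trace-class operators). The Koopman operators are $U^tf=f\circ\Phi^t$, acting on each $L^p(X,\mu)$; on $H$ they are unitary. Define $\mathcal U^t:\mathfrak B\to\mathfrak B$ by $\mathcal U^tA=U^tAU^{t*}$. A probability density is $p\in\mathfrak A_*$ with $p\ge 0$, $\int_X p\,d\mu=1$; it induces the normal state $\omega_p f=\int_X fp\,d\mu$ on $\mathfrak A$. A density operator is a positive $\rho\in\mathfrak B_*$ with $\operatorname{tr}\rho=1$;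 it induces the normal state $\omega_\rho A=\operatorname{tr}(\rho A)$ on $\mathfrak B$. The sets of normal states are denoted $S_*(\mathfrak A)$, $S_*(\mathfrak B)$. The transfer operators are $P^t\omega=\omega\circ U^t$ on states of $\mathfrak A$ and $\mathcal P^t\omega=\omega\circ\mathcal U^t$ on states of $\mathfrak B$; they preserve normal states. $\pi:\mathfrak A\to\mathfrak B$ maps $f$ to the multiplication operator $(\pi f)g=fg$. $\Gamma:S_*(\mathfrak A)\to S_*(\mathfrak B)$ is defined by $\Gamma(\omega_p)=\omega_\rho$ with $\rho=\langle\sqrt p,\cdot\rangle\sqrt p$. *)

theory Defs
  imports "HOL-Probability.Probability" "HOL-Library.Nonpos_Ints"
begin

section \<open>Ergodic flows\<close>

text \<open>A completely metrizable, separable space is a type of class \<open>polish_space\<close>; only its Borel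
  structure enters below.\<close>

definition measurable_flow :: "(real \<Rightarrow> 'a::topological_space \<Rightarrow> 'a) \<Rightarrow> bool" where
  "measurable_flow \<Phi> \<longleftrightarrow>
     (\<lambda>(t, x). \<Phi> t x) \<in> borel \<Otimes>\<^sub>M borel \<rightarrow>\<^sub>M borel \<and>
     (\<forall>x. \<Phi> 0 x = x) \<and> (\<forall>s t x. \<Phi> (s + t) x = \<Phi> s (\<Phi> t x))"

definition flow_invariant :: "(real \<Rightarrow> 'a \<Rightarrow> 'a) \<Rightarrow> 'a measure \<Rightarrow> bool" where
  "flow_invariant \<Phi> M \<longleftrightarrow> (\<forall>t. distr M M (\<Phi> t) = M)"

definition flow_ergodic :: "(real \<Rightarrow> 'a \<Rightarrow> 'a) \<Rightarrow> 'a measure \<Rightarrow> bool" where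
  "flow_ergodic \<Phi> M \<longleftrightarrow>
     (\<forall>S\<in>sets M. (\<forall>t. \<Phi> t -` S \<inter> space M = S) \<longrightarrow> measure M S = 0 \<or> measure M S = 1)"


section \<open>Function classes and Lebesgue spaces\<close>

text \<open>Elements of \<open>L\<^sup>p(M)\<close> are equivalence classes of complex measurable functions modulo equality
  almost everywhere. A class is a set of functions, and operations on classes are computed on
  representatives.\<close>

type_synonym 'a fclass = "('a \<Rightarrow> complex) set"

definition ae_class :: "'a measure \<Rightarrow> ('a \<Rightarrow> complex) \<Rightarrow> 'a fclass" where
  "ae_class M f = {g \<in> borel_measurable M. AE x in M. g x = f x}"

definition rep :: "'a fclass \<Rightarrow> 'a \<Rightarrow> complex" where
  "rep F = (SOME f. f \<in> F)"

definition L1 :: "'a measure \<Rightarrow> 'a fclass set" where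
  "L1 M = {ae_class M f | f. f \<in> borel_measurable M \<and> integrable M f}"

definition L2 :: "'a measure \<Rightarrow> 'a fclass set" where
  "L2 M = {ae_class M f | f. f \<in> borel_measurable M \<and> integrable M (\<lambda>x. (cmod (f x))\<^sup>2)}"

definition Linf :: "'a measure \<Rightarrow> 'a fclass set" where
  "Linf M = {ae_class M f | f. f \<in> borel_measurable M \<and> (\<exists>C. AE x in M. cmod (f x) \<le> C)}"

definition cl_add :: "'a measure \<Rightarrow> 'a fclass \<Rightarrow> 'a fclass \<Rightarrow> 'a fclass" where
  "cl_add M F G = ae_class M (\<lambda>x. rep F x + rep G x)"

definition cl_scale :: "'a measure \<Rightarrow> complex \<Rightarrow> 'a fclass \<Rightarrow> 'a fclass" where
  "cl_scale M c F = ae_class M (\<lambda>x. c * rep F x)"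

definition cl_mult :: "'a measure \<Rightarrow> 'a fclass \<Rightarrow> 'a fclass \<Rightarrow> 'a fclass" where
  "cl_mult M F G = ae_class M (\<lambda>x. rep F x * rep G x)"

definition cl_cnj :: "'a measure \<Rightarrow> 'a fclass \<Rightarrow> 'a fclass" where
  "cl_cnj M F = ae_class M (\<lambda>x. cnj (rep F x))"

definition cl_sqrt :: "'a measure \<Rightarrow> 'a fclass \<Rightarrow> 'a fclass" where
  "cl_sqrt M F = ae_class M (\<lambda>x. csqrt (rep F x))"

definition Linf_norm :: "'a measure \<Rightarrow> 'a fclass \<Rightarrow> real" where
  "Linf_norm M F = real_of_ereal (esssup M (\<lambda>x. ereal (cmod (rep F x))))"

definition L2_inner :: "'a measure \<Rightarrow> 'a fclass \<Rightarrow> 'a fclass \<Rightarrow> complex" where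
  "L2_inner M F G = (\<integral>x. cnj (rep F x) * rep G x \<partial>M)"

definition L2_norm :: "'a measure \<Rightarrow> 'a fclass \<Rightarrow> real" where
  "L2_norm M F = sqrt (\<integral>x. (cmod (rep F x))\<^sup>2 \<partial>M)"

definition koopman :: "'a measure \<Rightarrow> (real \<Rightarrow> 'a \<Rightarrow> 'a) \<Rightarrow> real \<Rightarrow> 'a fclass \<Rightarrow> 'a fclass" where
  "koopman M \<Phi> t F = ae_class M (\<lambda>x. rep F (\<Phi> t x))"


section \<open>Bounded operators on \<open>L\<^sup>2\<close>\<close>

text \<open>An operator is an extensional function on \<^term>\<open>L2 M\<close>, so that equality of operators is
  equality in HOL; \<^term>\<open>compose (L2 M) A B\<close> is the operator product \<open>A B\<close>.\<close>

type_synonym 'a oper = "'a fclass \<Rightarrow> 'a fclass"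

definition BH :: "'a measure \<Rightarrow> 'a oper set" where
  "BH M = {A \<in> L2 M \<rightarrow>\<^sub>E L2 M.
     (\<forall>F\<in>L2 M. \<forall>G\<in>L2 M. A (cl_add M F G) = cl_add M (A F) (A G)) \<and>
     (\<forall>c. \<forall>F\<in>L2 M. A (cl_scale M c F) = cl_scale M c (A F)) \<and>
     (\<exists>C. \<forall>F\<in>L2 M. L2_norm M (A F) \<le> C * L2_norm M F)}"

definition op_add :: "'a measure \<Rightarrow> 'a oper \<Rightarrow> 'a oper \<Rightarrow> 'a oper" where
  "op_add M A B = (\<lambda>F\<in>L2 M. cl_add M (A F) (B F))"

definition op_scale :: "'a measure \<Rightarrow> complex \<Rightarrow> 'a oper \<Rightarrow> 'a oper" where
  "op_scale M c A = (\<lambda>F\<in>L2 M. cl_scale M c (A F))"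

definition op_adj :: "'a measure \<Rightarrow> 'a oper \<Rightarrow> 'a oper" where
  "op_adj M A = (THE B. B \<in> BH M \<and>
     (\<forall>F\<in>L2 M. \<forall>G\<in>L2 M. L2_inner M (B F) G = L2_inner M F (A G)))"

definition op_norm :: "'a measure \<Rightarrow> 'a oper \<Rightarrow> real" where
  "op_norm M A = Sup {L2_norm M (A F) | F. F \<in> L2 M \<and> L2_norm M F \<le> 1}"

definition op_positive :: "'a measure \<Rightarrow> 'a oper \<Rightarrow> bool" where
  "op_positive M A \<longleftrightarrow> A \<in> BH M \<and> (\<forall>F\<in>L2 M. L2_inner M F (A F) \<in> \<real>\<^sub>\<ge>\<^sub>0)"

definition koopman_op :: "'a measure \<Rightarrow> (real \<Rightarrow> 'a \<Rightarrow> 'a) \<Rightarrow> real \<Rightarrow> 'a oper" where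
  "koopman_op M \<Phi> t = (\<lambda>F\<in>L2 M. koopman M \<Phi> t F)"

definition koopman_conj :: "'a measure \<Rightarrow> (real \<Rightarrow> 'a \<Rightarrow> 'a) \<Rightarrow> real \<Rightarrow> 'a oper \<Rightarrow> 'a oper" where
  "koopman_conj M \<Phi> t A =
     compose (L2 M) (koopman_op M \<Phi> t) (compose (L2 M) A (op_adj M (koopman_op M \<Phi> t)))"

definition mult_op :: "'a measure \<Rightarrow> 'a fclass \<Rightarrow> 'a oper" where
  "mult_op M F = (\<lambda>G\<in>L2 M. cl_mult M F G)"

definition rank_one :: "'a measure \<Rightarrow> 'a fclass \<Rightarrow> 'a oper" where
  "rank_one M \<psi> = (\<lambda>F\<in>L2 M. cl_scale M (L2_inner M \<psi> F) \<psi>)"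

definition star_homomorphism :: "'a measure \<Rightarrow> ('a fclass \<Rightarrow> 'a oper) \<Rightarrow> bool" where
  "star_homomorphism M h \<longleftrightarrow>
     h \<in> Linf M \<rightarrow> BH M \<and>
     (\<forall>F\<in>Linf M. \<forall>G\<in>Linf M. h (cl_add M F G) = op_add M (h F) (h G)) \<and>
     (\<forall>c. \<forall>F\<in>Linf M. h (cl_scale M c F) = op_scale M c (h F)) \<and>
     (\<forall>F\<in>Linf M. \<forall>G\<in>Linf M. h (cl_mult M F G) = compose (L2 M) (h F) (h G)) \<and>
     (\<forall>F\<in>Linf M. h (cl_cnj M F) = op_adj M (h F))"


section \<open>Trace-class operators\<close>

definition onb :: "'a measure \<Rightarrow> 'a fclass set \<Rightarrow> bool" where
  "onb M E \<longleftrightarrow> E \<subseteq> L2 M \<and>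
     (\<forall>e\<in>E. \<forall>e'\<in>E. L2_inner M e e' = (if e = e' then 1 else 0)) \<and>
     (\<forall>F\<in>L2 M. \<forall>\<epsilon>>0. \<exists>S c. finite S \<and> S \<subseteq> E \<and>
        L2_norm M (ae_class M (\<lambda>x. rep F x - (\<Sum>e\<in>S. c e * rep e x))) < \<epsilon>)"

text \<open>In the next definition \<open>P\<close> is the absolute value of \<open>A\<close>, the unique positive square root
  of \<open>A\<^sup>* A\<close>.\<close>

definition trace_class :: "'a measure \<Rightarrow> 'a oper set" where
  "trace_class M = {A \<in> BH M. \<exists>P E. op_positive M P \<and>
     compose (L2 M) P P = compose (L2 M) (op_adj M A) A \<and>
     onb M E \<and> (\<lambda>e. L2_inner M e (P e)) summable_on E}"

text \<open>For trace-class operators the trace does not depend on the orthonormal basis.\<close>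

definition op_trace :: "'a measure \<Rightarrow> 'a oper \<Rightarrow> complex" where
  "op_trace M A = (\<Sum>\<^sub>\<infinity>e\<in>(SOME E. onb M E). L2_inner M e (A e))"


section \<open>Normal states\<close>

definition prob_density :: "'a measure \<Rightarrow> 'a fclass \<Rightarrow> bool" where
  "prob_density M p \<longleftrightarrow> p \<in> L1 M \<and> (AE x in M. rep p x \<in> \<real>\<^sub>\<ge>\<^sub>0) \<and> (\<integral>x. rep p x \<partial>M) = 1"

definition density_operator :: "'a measure \<Rightarrow> 'a oper \<Rightarrow> bool" where
  "density_operator M \<rho> \<longleftrightarrow> \<rho> \<in> trace_class M \<and> op_positive M \<rho> \<and> op_trace M \<rho> = 1"

definition state_of_density :: "'a measure \<Rightarrow> 'a fclass \<Rightarrow> ('a fclass \<Rightarrow> complex)" where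
  "state_of_density M p = (\<lambda>F\<in>Linf M. \<integral>x. rep F x * rep p x \<partial>M)"

definition state_of_operator :: "'a measure \<Rightarrow> 'a oper \<Rightarrow> ('a oper \<Rightarrow> complex)" where
  "state_of_operator M \<rho> = (\<lambda>A\<in>BH M. op_trace M (compose (L2 M) \<rho> A))"

definition normal_states_Linf :: "'a measure \<Rightarrow> ('a fclass \<Rightarrow> complex) set" where
  "normal_states_Linf M = {state_of_density M p | p. prob_density M p}"

definition normal_states_BH :: "'a measure \<Rightarrow> ('a oper \<Rightarrow> complex) set" where
  "normal_states_BH M = {state_of_operator M \<rho> | \<rho>. density_operator M \<rho>}"

definition transfer_Linf ::
  "'a measure \<Rightarrow> (real \<Rightarrow> 'a \<Rightarrow> 'a) \<Rightarrow> real \<Rightarrow> ('a fclass \<Rightarrow> complex) \<Rightarrow> ('a fclass \<Rightarrow> complex)" where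
  "transfer_Linf M \<Phi> t \<omega> = compose (Linf M) \<omega> (koopman M \<Phi> t)"

definition transfer_BH ::
  "'a measure \<Rightarrow> (real \<Rightarrow> 'a \<Rightarrow> 'a) \<Rightarrow> real \<Rightarrow> ('a oper \<Rightarrow> complex) \<Rightarrow> ('a oper \<Rightarrow> complex)" where
  "transfer_BH M \<Phi> t \<omega> = compose (BH M) \<omega> (koopman_conj M \<Phi> t)"

definition embed_state :: "'a measure \<Rightarrow> ('a fclass \<Rightarrow> complex) \<Rightarrow> ('a oper \<Rightarrow> complex)" where
  "embed_state M \<omega> =
     state_of_operator M
       (rank_one M (cl_sqrt M (THE p. prob_density M p \<and> state_of_density M p = \<omega>)))"

text \<open>A density is determined by the state it induces, so \<open>embed_state\<close> is well defined.\<close>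

lemma rep_ae_class:
  assumes "f \<in> borel_measurable M"
  shows "rep (ae_class M f) \<in> borel_measurable M" "AE x in M. rep (ae_class M f) x = f x"
proof -
  have "f \<in> ae_class M f"
    using assms by (simp add: ae_class_def)
  then have "rep (ae_class M f) \<in> ae_class M f"
    unfolding rep_def by (rule someI[of "\<lambda>g. g \<in> ae_class M f"])
  then show "rep (ae_class M f) \<in> borel_measurable M" "AE x in M. rep (ae_class M f) x = f x"
    by (auto simp: ae_class_def)
qed

lemma ae_class_eqI:
  assumes "AE x in M. f x = g x"
  shows "ae_class M f = ae_class M g"
proof -
  have "(AE x in M. h x = f x) \<longleftrightarrow> (AE x in M. h x = g x)" for h
  proof
    show "AE x in M. h x = g x" if "AE x in M. h x = f x"
      using that assms by eventually_elim simp
    show "AE x in M. h x = f x" if "AE x in M. h x = g x"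
      using that assms by eventually_elim simp
  qed
  then show ?thesis
    by (simp add: ae_class_def)
qed

lemma L1_rep:
  assumes "p \<in> L1 M"
  shows "integrable M (rep p)" "ae_class M (rep p) = p"
proof -
  obtain f where f: "p = ae_class M f" "f \<in> borel_measurable M" "integrable M f"
    using assms by (auto simp: L1_def)
  note r = rep_ae_class[OF f(2)]
  show "integrable M (rep p)"
    unfolding f(1) using integrable_cong_AE[OF r(1) f(2) r(2)] f(3) by blast
  show "ae_class M (rep p) = p"
    unfolding f(1) by (rule ae_class_eqI[OF r(2)])
qed

lemma state_of_density_inj:
  assumes M: "prob_space M" and p: "prob_density M p" and q: "prob_density M q"
    and eq: "state_of_density M p = state_of_density M q"
  shows "p = q"
proof -
  interpret prob_space M by (rule M)
  have L: "p \<in> L1 M" "q \<in> L1 M"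
    using p q by (auto simp: prob_density_def)
  have [measurable]: "rep p \<in> borel_measurable M" "rep q \<in> borel_measurable M"
    by (rule borel_measurable_integrable[OF L1_rep(1)[OF L(1)]])
      (rule borel_measurable_integrable[OF L1_rep(1)[OF L(2)]])
  have "AE x in M. rep p x = rep q x"
  proof (rule density_unique_banach[OF L1_rep(1)[OF L(1)] L1_rep(1)[OF L(2)]])
    fix S assume S[measurable]: "S \<in> sets M"
    define i :: "'a \<Rightarrow> complex" where "i = indicator S"
    have i[measurable]: "i \<in> borel_measurable M"
      by (simp add: i_def)
    have mem: "ae_class M i \<in> Linf M"
    proof -
      have "AE x in M. cmod (i x) \<le> 1"
        by (rule AE_I2) (simp add: i_def indicator_def)
      with i show ?thesis
        unfolding Linf_def by blast
    qed
    note r = rep_ae_class[OF i]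
    note [measurable] = r(1)
    have *: "(\<integral>x. rep (ae_class M i) x * rep u x \<partial>M) = set_lebesgue_integral M S (rep u)"
      if [measurable]: "rep u \<in> borel_measurable M" for u
      unfolding set_lebesgue_integral_def
    proof (rule integral_cong_AE)
      show "AE x in M. rep (ae_class M i) x * rep u x = indicator S x *\<^sub>R rep u x"
        using r(2) by eventually_elim (simp add: i_def indicator_def)
    qed measurable
    have "state_of_density M p (ae_class M i) = state_of_density M q (ae_class M i)"
      by (simp add: eq)
    then show "set_lebesgue_integral M S (rep p) = set_lebesgue_integral M S (rep q)"
      unfolding state_of_density_def restrict_apply'[OF mem]
      by (simp only: *[OF \<open>rep p \<in> borel_measurable M\<close>] *[OF \<open>rep q \<in> borel_measurable M\<close>])
  qed
  then have "ae_class M (rep p) = ae_class M (rep q)"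
    by (rule ae_class_eqI)
  then show ?thesis
    by (simp only: L1_rep(2)[OF L(1)] L1_rep(2)[OF L(2)])
qed

lemma embed_state_of_density:
  assumes M: "prob_space M" and "prob_density M p"
  shows "embed_state M (state_of_density M p) =
    state_of_operator M (rank_one M (cl_sqrt M p))"
proof -
  have "(THE q. prob_density M q \<and> state_of_density M q = state_of_density M p) = p"
    by (rule the_equality) (use assms state_of_density_inj[OF M _ assms(2)] in simp_all)
  then show ?thesis
    by (simp add: embed_state_def)
qed

end

theory Submission
  imports Defs
begin

text \<open>
  The proof rests on a formula for pure states. If \<open>\<rho> = \<langle>\<psi>, \<cdot>\<rangle>\<psi>\<close> is the rank-one operator of a unit vector
  \<open>\<psi>\<close>, then expanding \<open>\<psi>\<close> in an orthonormal basis \<open>E\<close> gives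
  \<open>tr (\<rho> A) = \<Sum>\<^sub>e \<langle>\<psi>, A e\<rangle> \<langle>e, \<psi>\<rangle> = \<langle>\<psi>, A \<psi>\<rangle>\<close> for every bounded \<open>A\<close> (\<open>Parseval_operator\<close>,
  \<open>op_trace_rank_one_compose\<close>). So the embedding \<open>\<Gamma>\<close> sends the state with density \<open>p\<close> to the vector state
  of \<open>\<surd>p\<close> (\<open>embed_state_eq\<close>), and the claims about states become identities between integrals:

  \<^item> \<open>\<langle>\<surd>p, F \<surd>p\<rangle> = \<integral> F p\<close>, which for \<open>F = 1\<close> also says that \<open>\<surd>p\<close> is a unit vector
    (\<open>L2_inner_sqrt_density\<close>), so that its rank-one operator is a projection and a density operator;

  \<^item> \<open>\<langle>\<surd>p, U\<^sup>t A U\<^sup>-\<^sup>t \<surd>p\<rangle> = \<langle>U\<^sup>-\<^sup>t \<surd>p, A U\<^sup>-\<^sup>t \<surd>p\<rangle>\<close> by unitarity of the Koopman operators, where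
    \<open>U\<^sup>-\<^sup>t \<surd>p = \<surd>(U\<^sup>-\<^sup>t p)\<close>, while \<open>U\<^sup>-\<^sup>t p\<close> is the density of the transported classical state
    (\<open>transfer_embed_state\<close>).

  The trace needs an orthonormal basis of \<open>L\<^sup>2\<close>. The Borel sets of a second-countable space are generated by a
  countable \<open>\<pi>\<close>-system, the indicators of its members span a dense subspace by a Dynkin-system argument and
  approximation by simple functions, and Gram-Schmidt turns them into a basis (\<open>onb_exists\<close>).

  That \<open>\<pi>\<close> is a \<open>\<^sup>*\<close>-homomorphism and intertwines the dynamics is pointwise algebra modulo null sets. It is
  injective because a multiplication operator maps \<open>1\<close> to its symbol, and isometric because a function
  concentrated where \<open>|F|\<close> is close to its essential supremum is stretched by almost that amount
  (\<open>op_norm_mult_op\<close>).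
\<close>

section \<open>The function-level calculus of square-integrable functions\<close>

text \<open>Inner products and norms are treated on honest functions, where the algebra is that of the integral,
  and carried over to classes through their representatives. \<open>sqnorm\<close> is the square of the \<open>L\<^sup>2\<close> norm:
  the parallelogram bound \<open>sqnorm_add_le\<close> then replaces the triangle inequality and avoids square roots.\<close>

definition square_integrable :: "'a measure \<Rightarrow> ('a \<Rightarrow> complex) \<Rightarrow> bool" where
  "square_integrable M f \<longleftrightarrow> f \<in> borel_measurable M \<and> integrable M (\<lambda>x. (cmod (f x))\<^sup>2)"

definition fun_inner :: "'a measure \<Rightarrow> ('a \<Rightarrow> complex) \<Rightarrow> ('a \<Rightarrow> complex) \<Rightarrow> complex" where
  "fun_inner M f g = (\<integral>x. cnj (f x) * g x \<partial>M)"

definition sqnorm :: "'a measure \<Rightarrow> ('a \<Rightarrow> complex) \<Rightarrow> real" where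
  "sqnorm M f = (\<integral>x. (cmod (f x))\<^sup>2 \<partial>M)"

lemma square_integrable_measurable[measurable_dest]:
  "square_integrable M f \<Longrightarrow> f \<in> borel_measurable M"
  by (simp add: square_integrable_def)

lemma borel_measurable_cnj[measurable]:
  "f \<in> borel_measurable M \<Longrightarrow> (\<lambda>x. cnj (f x)) \<in> borel_measurable M"
  by (rule measurable_compose[OF _ borel_measurable_continuous_onI]) (auto intro: continuous_intros)

lemma square_integrable_zero[simp]: "square_integrable M (\<lambda>x. 0)"
  by (simp add: square_integrable_def)

lemma cmod_add_square_le: "(cmod (a + b))\<^sup>2 \<le> 2 * (cmod a)\<^sup>2 + 2 * (cmod b)\<^sup>2"
proof -
  have "(cmod (a + b))\<^sup>2 \<le> (cmod a + cmod b)\<^sup>2"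
    by (intro power_mono norm_triangle_ineq norm_ge_zero)
  also have "\<dots> \<le> 2 * (cmod a)\<^sup>2 + 2 * (cmod b)\<^sup>2"
    using sum_squares_ge_zero[of "cmod a - cmod b" 0] by (simp add: power2_eq_square algebra_simps)
  finally show ?thesis .
qed

lemma square_integrable_bound:
  assumes "g \<in> borel_measurable M" "integrable M w" "AE x in M. (cmod (g x))\<^sup>2 \<le> w x"
  shows "square_integrable M g"
  unfolding square_integrable_def
proof
  show "integrable M (\<lambda>x. (cmod (g x))\<^sup>2)"
  proof (rule Bochner_Integration.integrable_bound[OF assms(2)])
    show "AE x in M. norm ((cmod (g x))\<^sup>2) \<le> norm (w x)"
      using assms(3) by eventually_elim simp
  qed (use assms(1) in measurable)
qed (rule assms(1))

lemma square_integrable_add: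
  assumes "square_integrable M f" "square_integrable M g"
  shows "square_integrable M (\<lambda>x. f x + g x)"
proof (rule square_integrable_bound)
  show "integrable M (\<lambda>x. 2 * (cmod (f x))\<^sup>2 + 2 * (cmod (g x))\<^sup>2)"
    using assms by (simp add: square_integrable_def)
  show "(\<lambda>x. f x + g x) \<in> borel_measurable M"
    using assms by measurable
qed (simp add: cmod_add_square_le)

lemma square_integrable_scale:
  assumes "square_integrable M f"
  shows "square_integrable M (\<lambda>x. c * f x)"
  using assms by (auto simp: square_integrable_def norm_mult power_mult_distrib)

lemma square_integrable_diff:
  assumes "square_integrable M f" "square_integrable M g"
  shows "square_integrable M (\<lambda>x. f x - g x)"
  using square_integrable_add[OF assms(1) square_integrable_scale[OF assms(2), of "-1"]] by simp

lemma square_integrable_sum: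
  assumes "\<And>i. i \<in> S \<Longrightarrow> square_integrable M (u i)"
  shows "square_integrable M (\<lambda>x. \<Sum>i\<in>S. c i * u i x)"
  using assms
  by (induction S rule: infinite_finite_induct) (auto intro!: square_integrable_add square_integrable_scale)

lemma square_integrable_cong_AE:
  assumes "square_integrable M f" "g \<in> borel_measurable M" "AE x in M. g x = f x"
  shows "square_integrable M g"
  by (rule square_integrable_bound[where w = "\<lambda>x. (cmod (f x))\<^sup>2"])
    (use assms in \<open>auto simp: square_integrable_def\<close>)

lemma integrable_cnj_mult:
  assumes "square_integrable M f" "square_integrable M g"
  shows "integrable M (\<lambda>x. cnj (f x) * g x)"
proof (rule Bochner_Integration.integrable_bound)
  show "integrable M (\<lambda>x. (cmod (f x))\<^sup>2 + (cmod (g x))\<^sup>2)"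
    using assms by (simp add: square_integrable_def)
  have "a * b \<le> a\<^sup>2 + b\<^sup>2" if "a \<ge> 0" "b \<ge> 0" for a b :: real
    using sum_squares_bound[of a b] mult_nonneg_nonneg[OF that] by linarith
  then show "AE x in M. norm (cnj (f x) * g x) \<le> norm ((cmod (f x))\<^sup>2 + (cmod (g x))\<^sup>2)"
    by (simp add: norm_mult)
  show "(\<lambda>x. cnj (f x) * g x) \<in> borel_measurable M"
    using assms by measurable
qed

lemma fun_inner_cong_AE:
  assumes "f \<in> borel_measurable M" "f' \<in> borel_measurable M" "g \<in> borel_measurable M" "g' \<in> borel_measurable M"
    and "AE x in M. f x = f' x" "AE x in M. g x = g' x"
  shows "fun_inner M f g = fun_inner M f' g'"
  unfolding fun_inner_def
proof (rule integral_cong_AE)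
  show "AE x in M. cnj (f x) * g x = cnj (f' x) * g' x"
    using assms(5,6) by eventually_elim simp
qed (use assms(1-4) in \<open>auto intro!: borel_measurable_times borel_measurable_cnj\<close>)

lemma sqnorm_cong_AE:
  assumes "f \<in> borel_measurable M" "f' \<in> borel_measurable M" "AE x in M. f x = f' x"
  shows "sqnorm M f = sqnorm M f'"
  unfolding sqnorm_def
proof (rule integral_cong_AE)
  show "AE x in M. (cmod (f x))\<^sup>2 = (cmod (f' x))\<^sup>2"
    using assms(3) by eventually_elim simp
qed (use assms in measurable)

lemma sqnorm_nonneg[simp]: "0 \<le> sqnorm M f"
  by (simp add: sqnorm_def)

lemma fun_inner_self: "fun_inner M f f = of_real (sqnorm M f)"
proof -
  have "cnj z * z = of_real ((cmod z)\<^sup>2)" for z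
    using complex_norm_square[of z] by (simp add: mult.commute)
  then show ?thesis
    by (simp add: fun_inner_def sqnorm_def del: of_real_power)
qed

lemma fun_inner_commute: "fun_inner M g f = cnj (fun_inner M f g)"
proof -
  have "cnj (fun_inner M f g) = (\<integral>x. cnj (cnj (f x) * g x) \<partial>M)"
    unfolding fun_inner_def by (rule Bochner_Integration.integral_cnj[symmetric])
  then show ?thesis
    by (simp add: fun_inner_def mult.commute)
qed

lemma fun_inner_scale_right: "fun_inner M f (\<lambda>x. c * g x) = c * fun_inner M f g"
proof -
  have "(\<lambda>x. cnj (f x) * (c * g x)) = (\<lambda>x. c * (cnj (f x) * g x))"
    by (simp add: fun_eq_iff)
  then show ?thesis by (simp add: fun_inner_def)
qed

lemma fun_inner_add_right:
  assumes "square_integrable M f" "square_integrable M g" "square_integrable M h"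
  shows "fun_inner M f (\<lambda>x. g x + h x) = fun_inner M f g + fun_inner M f h"
  using integrable_cnj_mult[OF assms(1,2)] integrable_cnj_mult[OF assms(1,3)]
  by (simp add: fun_inner_def distrib_left)

lemma fun_inner_diff_right:
  assumes "square_integrable M f" "square_integrable M g" "square_integrable M h"
  shows "fun_inner M f (\<lambda>x. g x - h x) = fun_inner M f g - fun_inner M f h"
  using integrable_cnj_mult[OF assms(1,2)] integrable_cnj_mult[OF assms(1,3)]
  by (simp add: fun_inner_def right_diff_distrib)

lemma fun_inner_sum_right:
  assumes "square_integrable M f" "\<And>i. i \<in> S \<Longrightarrow> square_integrable M (u i)"
  shows "fun_inner M f (\<lambda>x. \<Sum>i\<in>S. c i * u i x) = (\<Sum>i\<in>S. c i * fun_inner M f (u i))"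
  using assms(2)
proof (induction S rule: infinite_finite_induct)
  case (insert i S)
  have "fun_inner M f (\<lambda>x. c i * u i x + (\<Sum>i\<in>S. c i * u i x)) =
      c i * fun_inner M f (u i) + fun_inner M f (\<lambda>x. \<Sum>i\<in>S. c i * u i x)"
    by (subst fun_inner_add_right)
      (use insert.prems assms(1) in \<open>auto intro: square_integrable_scale square_integrable_sum
        simp: fun_inner_scale_right\<close>)
  then show ?case
    using insert by simp
qed (simp_all add: fun_inner_def)

lemma sqnorm_scale: "sqnorm M (\<lambda>x. c * f x) = (cmod c)\<^sup>2 * sqnorm M f"
  by (simp add: sqnorm_def norm_mult power_mult_distrib)

lemma sqnorm_add:
  assumes "square_integrable M f" "square_integrable M g"
  shows "sqnorm M (\<lambda>x. f x + g x) = sqnorm M f + 2 * Re (fun_inner M f g) + sqnorm M g"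
proof -
  let ?h = "\<lambda>x. f x + g x"
  have h: "square_integrable M ?h"
    using assms by (rule square_integrable_add)
  have "of_real (sqnorm M ?h) = fun_inner M ?h f + fun_inner M ?h g"
    by (simp add: fun_inner_add_right[OF h assms] flip: fun_inner_self)
  also have "\<dots> = cnj (fun_inner M f f + fun_inner M f g) + cnj (fun_inner M g f + fun_inner M g g)"
    by (simp add: fun_inner_add_right[OF assms(1) assms] fun_inner_add_right[OF assms(2) assms]
        fun_inner_commute[of M ?h])
  finally have "Re (of_real (sqnorm M ?h)) =
      Re (cnj (fun_inner M f f + fun_inner M f g) + cnj (fun_inner M g f + fun_inner M g g))"
    by simp
  then show ?thesis
    by (simp add: fun_inner_self fun_inner_commute[of M g f])
qed

lemma sqnorm_add_le:
  assumes "square_integrable M f" "square_integrable M g"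
  shows "sqnorm M (\<lambda>x. f x + g x) \<le> 2 * sqnorm M f + 2 * sqnorm M g"
proof -
  have "sqnorm M (\<lambda>x. f x + g x) \<le> (\<integral>x. 2 * (cmod (f x))\<^sup>2 + 2 * (cmod (g x))\<^sup>2 \<partial>M)"
    unfolding sqnorm_def
    by (rule integral_mono)
      (use assms square_integrable_add[OF assms] in \<open>auto simp: square_integrable_def cmod_add_square_le\<close>)
  also have "\<dots> = 2 * sqnorm M f + 2 * sqnorm M g"
    using assms by (simp add: square_integrable_def sqnorm_def)
  finally show ?thesis .
qed

lemma sqnorm_eq_0_iff:
  assumes "square_integrable M f"
  shows "sqnorm M f = 0 \<longleftrightarrow> (AE x in M. f x = 0)"
  using integral_nonneg_eq_0_iff_AE[of M "\<lambda>x. (cmod (f x))\<^sup>2"] assms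
  by (simp add: sqnorm_def square_integrable_def)

text \<open>Subtracting from \<open>g\<close> its projection onto the line spanned by \<open>f\<close> leaves a function with
  nonnegative square norm.\<close>

lemma Cauchy_Schwarz_fun_inner:
  assumes f: "square_integrable M f" and g: "square_integrable M g"
  shows "(cmod (fun_inner M f g))\<^sup>2 \<le> sqnorm M f * sqnorm M g"
proof (cases "sqnorm M f = 0")
  case True
  then have "AE x in M. f x = 0"
    by (simp add: sqnorm_eq_0_iff[OF f])
  then have "fun_inner M f g = fun_inner M (\<lambda>x. 0) g"
    using f g by (intro fun_inner_cong_AE) auto
  then show ?thesis
    by (simp add: fun_inner_def)
next
  case False
  then have pos: "sqnorm M f > 0"
    by (simp add: order_less_le)
  define z where "z = fun_inner M f g"
  define c where "c = - z / of_real (sqnorm M f)"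
  have "0 \<le> sqnorm M (\<lambda>x. g x + c * f x)"
    by simp
  also have "\<dots> = sqnorm M g + 2 * Re (c * cnj z) + (cmod c)\<^sup>2 * sqnorm M f"
    by (simp add: sqnorm_add g f square_integrable_scale fun_inner_scale_right sqnorm_scale
        fun_inner_commute[of M g f] z_def)
  also have "c * cnj z = of_real (- ((cmod z)\<^sup>2 / sqnorm M f))"
    by (simp add: c_def complex_norm_square del: of_real_power)
  also have "(cmod c)\<^sup>2 * sqnorm M f = (cmod z)\<^sup>2 / sqnorm M f"
    using pos by (simp add: c_def norm_divide power_divide power2_eq_square)
  finally have "(cmod z)\<^sup>2 / sqnorm M f \<le> sqnorm M g"
    by simp
  then show ?thesis
    using pos by (simp add: z_def field_simps)
qed

text \<open>The error \<open>g\<close> of the Fourier sum is orthogonal to every \<open>u\<^sub>i\<close>, hence to the difference \<open>h\<close> between the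
  Fourier sum and any other combination, and the Pythagorean theorem applies to \<open>g + h\<close>.\<close>

lemma best_approximation:
  assumes S: "finite S" and u: "\<And>i. i \<in> S \<Longrightarrow> square_integrable M (u i)"
    and f: "square_integrable M f"
    and orth: "\<And>i j. i \<in> S \<Longrightarrow> j \<in> S \<Longrightarrow> fun_inner M (u i) (u j) = (if i = j then 1 else 0)"
  shows "sqnorm M (\<lambda>x. f x - (\<Sum>i\<in>S. fun_inner M (u i) f * u i x))
      \<le> sqnorm M (\<lambda>x. f x - (\<Sum>i\<in>S. c i * u i x))"
    and "j \<in> S \<Longrightarrow> fun_inner M (u j) (\<lambda>x. f x - (\<Sum>i\<in>S. fun_inner M (u i) f * u i x)) = 0"
proof -
  let ?a = "\<lambda>i. fun_inner M (u i) f"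
  define g where "g = (\<lambda>x. f x - (\<Sum>i\<in>S. ?a i * u i x))"
  define h where "h = (\<lambda>x. \<Sum>i\<in>S. (?a i - c i) * u i x)"
  have g: "square_integrable M g" and h: "square_integrable M h"
    unfolding g_def h_def by (auto intro!: square_integrable_diff square_integrable_sum f u)
  have gu: "fun_inner M (u j) g = 0" if "j \<in> S" for j
  proof -
    have "fun_inner M (u j) g = ?a j - (\<Sum>i\<in>S. ?a i * fun_inner M (u j) (u i))"
      unfolding g_def using that
      by (simp add: fun_inner_diff_right fun_inner_sum_right square_integrable_sum f u)
    also have "(\<Sum>i\<in>S. ?a i * fun_inner M (u j) (u i)) = (\<Sum>i\<in>S. if j = i then ?a i else 0)"
      by (rule sum.cong) (use that orth in auto)
    also have "\<dots> = ?a j"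
      using that S by simp
    finally show ?thesis by simp
  qed
  then show "j \<in> S \<Longrightarrow> fun_inner M (u j) (\<lambda>x. f x - (\<Sum>i\<in>S. ?a i * u i x)) = 0"
    by (simp add: g_def)
  have "fun_inner M g h = (\<Sum>i\<in>S. (?a i - c i) * fun_inner M g (u i))"
    unfolding h_def by (rule fun_inner_sum_right[OF g u])
  also have "\<dots> = 0"
    by (rule sum.neutral) (use gu in \<open>auto simp: fun_inner_commute[of M g]\<close>)
  finally have "sqnorm M g \<le> sqnorm M (\<lambda>x. g x + h x)"
    by (simp add: sqnorm_add[OF g h])
  moreover have "(\<lambda>x. g x + h x) = (\<lambda>x. f x - (\<Sum>i\<in>S. c i * u i x))"
    by (simp add: g_def h_def fun_eq_iff left_diff_distrib sum_subtractf)
  ultimately show "sqnorm M (\<lambda>x. f x - (\<Sum>i\<in>S. ?a i * u i x)) \<le> sqnorm M (\<lambda>x. f x - (\<Sum>i\<in>S. c i * u i x))"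
    by (simp add: g_def)
qed

lemma sqnorm_diff_tendsto_0:
  assumes "\<And>n. s n \<in> borel_measurable M" "f \<in> borel_measurable M"
    and "integrable M w" "\<And>n. AE x in M. (cmod (f x - s n x))\<^sup>2 \<le> w x"
    and "AE x in M. (\<lambda>n. s n x) \<longlonglongrightarrow> f x"
  shows "(\<lambda>n. sqnorm M (\<lambda>x. f x - s n x)) \<longlonglongrightarrow> 0"
proof -
  have "(\<lambda>n. \<integral>x. (cmod (f x - s n x))\<^sup>2 \<partial>M) \<longlonglongrightarrow> (\<integral>x. 0 \<partial>M)"
  proof (rule integral_dominated_convergence)
    show "AE x in M. (\<lambda>n. (cmod (f x - s n x))\<^sup>2) \<longlonglongrightarrow> 0"
      using assms(5)
    proof eventually_elim
      case (elim x)
      have "(\<lambda>n. (cmod (f x - s n x))\<^sup>2) \<longlonglongrightarrow> (cmod (f x - f x))\<^sup>2"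
        by (intro tendsto_intros elim)
      then show ?case by simp
    qed
      show "AE x in M. norm ((cmod (f x - s n x))\<^sup>2) \<le> w x" for n
      using assms(4)[of n] by simp
  qed (use assms(1-3) in auto)
  then show ?thesis
    by (simp add: sqnorm_def)
qed


section \<open>Existence of an orthonormal basis\<close>

lemma square_integrable_ae_class_L2: "square_integrable M f \<Longrightarrow> ae_class M f \<in> L2 M"
  by (auto simp: L2_def square_integrable_def)

lemma L2_rep:
  assumes "F \<in> L2 M"
  shows "square_integrable M (rep F)" "ae_class M (rep F) = F"
proof -
  obtain f where f: "F = ae_class M f" "square_integrable M f"
    using assms by (auto simp: L2_def square_integrable_def)
  note r = rep_ae_class[OF square_integrable_measurable[OF f(2)]]
  show "square_integrable M (rep F)"
    unfolding f(1) by (rule square_integrable_cong_AE[OF f(2) r])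
  show "ae_class M (rep F) = F"
    unfolding f(1) by (rule ae_class_eqI[OF r(2)])
qed

text \<open>Membership of \<open>f\<close> in the closed linear span of \<open>E\<close>, in the form in which the definition of an orthonormal
  basis demands it. The next lemmas show that these functions form a closed subspace.\<close>

definition spans_approximately :: "'a measure \<Rightarrow> 'a fclass set \<Rightarrow> ('a \<Rightarrow> complex) \<Rightarrow> bool" where
  "spans_approximately M E f \<longleftrightarrow> (\<forall>\<epsilon>>0. \<exists>S c. finite S \<and> S \<subseteq> E \<and>
     sqnorm M (\<lambda>x. f x - (\<Sum>e\<in>S. c e * rep e x)) < \<epsilon>)"

lemma square_integrable_combination:
  assumes "E \<subseteq> L2 M" "S \<subseteq> E"
  shows "square_integrable M (\<lambda>x. \<Sum>e\<in>S. c e * rep e x)"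
  by (rule square_integrable_sum) (use assms L2_rep(1) in blast)

lemma spans_approximately_combination:
  assumes "E \<subseteq> L2 M" "finite S" "S \<subseteq> E" "f \<in> borel_measurable M"
    and "AE x in M. f x = (\<Sum>e\<in>S. c e * rep e x)"
  shows "spans_approximately M E f"
  unfolding spans_approximately_def
proof (intro allI impI exI conjI)
  fix \<epsilon> :: real assume "\<epsilon> > 0"
  have "sqnorm M (\<lambda>x. f x - (\<Sum>e\<in>S. c e * rep e x)) = sqnorm M (\<lambda>x. 0)"
    by (rule sqnorm_cong_AE)
      (use assms square_integrable_measurable[OF square_integrable_combination[OF assms(1,3)]] in auto)
  then show "sqnorm M (\<lambda>x. f x - (\<Sum>e\<in>S. c e * rep e x)) < \<epsilon>"
    using \<open>\<epsilon> > 0\<close> by (simp add: sqnorm_def)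
qed (use assms in auto)

lemma spans_approximately_limit:
  assumes E: "E \<subseteq> L2 M" and f: "square_integrable M f"
    and lim: "\<And>\<epsilon>. \<epsilon> > 0 \<Longrightarrow>
      \<exists>g. square_integrable M g \<and> spans_approximately M E g \<and> sqnorm M (\<lambda>x. f x - g x) < \<epsilon>"
  shows "spans_approximately M E f"
  unfolding spans_approximately_def
proof (intro allI impI)
  fix \<epsilon> :: real assume "\<epsilon> > 0"
  then obtain g where g: "square_integrable M g" "spans_approximately M E g"
      "sqnorm M (\<lambda>x. f x - g x) < \<epsilon> / 4"
    using lim[of "\<epsilon> / 4"] by auto
  then obtain S c where S: "finite S" "S \<subseteq> E" "sqnorm M (\<lambda>x. g x - (\<Sum>e\<in>S. c e * rep e x)) < \<epsilon> / 4"
    using \<open>\<epsilon> > 0\<close> unfolding spans_approximately_def by (meson divide_pos_pos zero_less_numeral)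
  have "sqnorm M (\<lambda>x. (f x - g x) + (g x - (\<Sum>e\<in>S. c e * rep e x)))
      \<le> 2 * sqnorm M (\<lambda>x. f x - g x) + 2 * sqnorm M (\<lambda>x. g x - (\<Sum>e\<in>S. c e * rep e x))"
    by (intro sqnorm_add_le square_integrable_diff f g square_integrable_combination[OF E S(2)])
  also have "\<dots> < \<epsilon>"
    using g(3) S(3) by simp
  finally show "\<exists>S c. finite S \<and> S \<subseteq> E \<and> sqnorm M (\<lambda>x. f x - (\<Sum>e\<in>S. c e * rep e x)) < \<epsilon>"
    using S(1,2) by (intro exI[of _ S] exI[of _ c]) simp
qed

lemma spans_approximately_scale:
  assumes f: "spans_approximately M E f"
  shows "spans_approximately M E (\<lambda>x. a * f x)"
proof (cases "a = 0")
  case True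
  then show ?thesis
    by (auto simp: spans_approximately_def sqnorm_def intro!: exI[of _ "{}"])
next
  case False
  show ?thesis
    unfolding spans_approximately_def
  proof (intro allI impI)
    fix \<epsilon> :: real assume "\<epsilon> > 0"
    then have "\<epsilon> / (cmod a)\<^sup>2 > 0"
      using False by simp
    then obtain S c where S: "finite S" "S \<subseteq> E"
        "sqnorm M (\<lambda>x. f x - (\<Sum>e\<in>S. c e * rep e x)) < \<epsilon> / (cmod a)\<^sup>2"
      using f unfolding spans_approximately_def by blast
    have eq: "(\<lambda>x. a * f x - (\<Sum>e\<in>S. (a * c e) * rep e x)) = (\<lambda>x. a * (f x - (\<Sum>e\<in>S. c e * rep e x)))"
      by (simp add: fun_eq_iff right_diff_distrib sum_distrib_left mult.assoc)
    have "sqnorm M (\<lambda>x. a * f x - (\<Sum>e\<in>S. (a * c e) * rep e x)) < \<epsilon>"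
      unfolding eq sqnorm_scale using S(3) False by (simp add: pos_less_divide_eq mult.commute)
    then show "\<exists>S c. finite S \<and> S \<subseteq> E \<and> sqnorm M (\<lambda>x. a * f x - (\<Sum>e\<in>S. c e * rep e x)) < \<epsilon>"
      using S(1,2) by (intro exI[of _ S] exI[of _ "\<lambda>e. a * c e"]) simp
  qed
qed

lemma spans_approximately_add:
  assumes E: "E \<subseteq> L2 M" and f: "square_integrable M f" and g: "square_integrable M g"
    and af: "spans_approximately M E f" and ag: "spans_approximately M E g"
  shows "spans_approximately M E (\<lambda>x. f x + g x)"
  unfolding spans_approximately_def
proof (intro allI impI)
  fix \<epsilon> :: real assume "\<epsilon> > 0"
  then have pos: "\<epsilon> / 4 > 0" by simp
  obtain S c where S: "finite S" "S \<subseteq> E" "sqnorm M (\<lambda>x. f x - (\<Sum>e\<in>S. c e * rep e x)) < \<epsilon> / 4"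
    using af pos unfolding spans_approximately_def by blast
  obtain T d where T: "finite T" "T \<subseteq> E" "sqnorm M (\<lambda>x. g x - (\<Sum>e\<in>T. d e * rep e x)) < \<epsilon> / 4"
    using ag pos unfolding spans_approximately_def by blast
  let ?b = "\<lambda>e. (if e \<in> S then c e else 0) + (if e \<in> T then d e else 0)"
  have "(\<Sum>e\<in>S \<union> T. ?b e * rep e x) = (\<Sum>e\<in>S. c e * rep e x) + (\<Sum>e\<in>T. d e * rep e x)" for x
  proof -
    have "(\<Sum>e\<in>S \<union> T. (if e \<in> S then c e else 0) * rep e x) = (\<Sum>e\<in>S. c e * rep e x)"
      using S(1) T(1) by (intro sum.mono_neutral_cong_right) auto
    moreover have "(\<Sum>e\<in>S \<union> T. (if e \<in> T then d e else 0) * rep e x) = (\<Sum>e\<in>T. d e * rep e x)"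
      using S(1) T(1) by (intro sum.mono_neutral_cong_right) auto
    ultimately show ?thesis
      by (simp only: distrib_right sum.distrib)
  qed
  then have "sqnorm M (\<lambda>x. f x + g x - (\<Sum>e\<in>S \<union> T. ?b e * rep e x)) =
      sqnorm M (\<lambda>x. (f x - (\<Sum>e\<in>S. c e * rep e x)) + (g x - (\<Sum>e\<in>T. d e * rep e x)))"
    by (simp only: add_diff_add)
  also have "\<dots> \<le> 2 * sqnorm M (\<lambda>x. f x - (\<Sum>e\<in>S. c e * rep e x)) + 2 * sqnorm M (\<lambda>x. g x - (\<Sum>e\<in>T. d e * rep e x))"
    by (intro sqnorm_add_le square_integrable_diff f g square_integrable_combination[OF E] S(2) T(2))
  also have "\<dots> < \<epsilon>"
    using S(3) T(3) by simp
  finally show "\<exists>S c. finite S \<and> S \<subseteq> E \<and> sqnorm M (\<lambda>x. f x + g x - (\<Sum>e\<in>S. c e * rep e x)) < \<epsilon>"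
    using S(1,2) T(1,2) by (intro exI[of _ "S \<union> T"] exI[of _ ?b]) simp
qed

lemma spans_approximately_sum:
  assumes E: "E \<subseteq> L2 M"
    and "\<And>i. i \<in> I \<Longrightarrow> square_integrable M (f i) \<and> spans_approximately M E (f i)"
  shows "spans_approximately M E (\<lambda>x. \<Sum>i\<in>I. a i * f i x)"
  using assms(2)
proof (induction I rule: infinite_finite_induct)
  case (insert i I)
  have "spans_approximately M E (\<lambda>x. a i * f i x + (\<Sum>i\<in>I. a i * f i x))"
    by (rule spans_approximately_add[OF E])
      (use insert in \<open>auto intro: square_integrable_scale square_integrable_sum spans_approximately_scale\<close>)
  then show ?case
    using insert by simp
qed (auto simp: spans_approximately_def sqnorm_def intro!: exI[of _ "{}"])

lemma (in finite_measure) square_integrable_bounded: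
  assumes "f \<in> borel_measurable M" "AE x in M. cmod (f x) \<le> C"
  shows "square_integrable M f"
proof (rule square_integrable_bound[OF assms(1)])
  show "integrable M (\<lambda>x. C\<^sup>2)"
    by simp
  show "AE x in M. (cmod (f x))\<^sup>2 \<le> C\<^sup>2"
    using assms(2) by eventually_elim (auto intro: power_mono)
qed

lemma (in finite_measure) square_integrable_indicator:
  "A \<in> sets M \<Longrightarrow> square_integrable M (indicator A)"
  by (rule square_integrable_bounded[where C = 1]) (auto simp: indicator_def)

text \<open>A Dynkin-system argument: the sets whose indicator lies in a closed subspace containing the constants
  are closed under complements and countable disjoint unions, since the partial unions converge in
  \<open>L\<^sup>2\<close> by dominated convergence.\<close>

lemma (in finite_measure) spans_approximately_indicator:
  assumes E: "E \<subseteq> L2 M" and sets: "sets M = sigma_sets (space M) G"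
    and G: "Int_stable G" "G \<subseteq> Pow (space M)" "space M \<in> G"
    and basic: "\<And>A. A \<in> G \<Longrightarrow> spans_approximately M E (indicator A)"
    and A: "A \<in> sets M"
  shows "spans_approximately M E (indicator A)"
proof -
  have "A \<in> sigma_sets (space M) G"
    using A sets by simp
  from G(1,2) this show ?thesis
  proof (induction A rule: sigma_sets_induct_disjoint)
    case (basic A)
    then show ?case by (rule assms(6))
  next
    case empty
    have "(\<lambda>x. 0 * indicator (space M) x) = (indicator {} :: _ \<Rightarrow> complex)"
      by (simp add: fun_eq_iff)
    then show ?case
      using spans_approximately_scale[OF assms(6)[OF G(3)], of 0] by simp
  next
    case (compl A)
    then have A: "A \<in> sets M" by (simp add: sets)
    have "spans_approximately M E (\<lambda>x. indicator (space M) x + (-1) * indicator A x)"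
      using compl(2) assms(6)[OF G(3)] A
      by (intro spans_approximately_add E spans_approximately_scale square_integrable_scale
          square_integrable_indicator) auto
    also have "(\<lambda>x. indicator (space M) x + (-1) * indicator A x) = (indicator (space M - A) :: _ \<Rightarrow> complex)"
      using sets.sets_into_space[OF A] by (auto simp: indicator_def fun_eq_iff)
    finally show ?case .
  next
    case (union A)
    have A: "A i \<in> sets M" for i
      using union(2) sets by auto
    let ?U = "\<Union>i. A i"
    define s :: "nat \<Rightarrow> 'a \<Rightarrow> complex" where "s n = indicator (\<Union>i<n. A i)" for n
    have s_sum: "s n = (\<lambda>x. \<Sum>i<n. 1 * indicator (A i) x)" for n
    proof
      fix x
      have "disjoint_family_on A {..<n}"
        using union(1) by (rule disjoint_family_on_mono[rotated]) simp
      then show "s n x = (\<Sum>i<n. 1 * indicator (A i) x)"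
        unfolding s_def mult_1 by (intro indicator_UN_disjoint) simp_all
    qed
    have sq: "square_integrable M (s n)" for n
      unfolding s_def using A by (intro square_integrable_indicator) auto
    have conv: "(\<lambda>n. sqnorm M (\<lambda>x. indicator ?U x - s n x)) \<longlonglongrightarrow> 0"
    proof (rule sqnorm_diff_tendsto_0)
      show "s n \<in> borel_measurable M" for n
        using sq by (rule square_integrable_measurable)
      show "indicator ?U \<in> borel_measurable M"
        using A by (intro borel_measurable_indicator sets.countable_UN) auto
      show "integrable M (\<lambda>x. 1 :: real)" by simp
      show "AE x in M. (cmod (indicator ?U x - s n x))\<^sup>2 \<le> 1" for n
        by (rule AE_I2) (auto simp: indicator_def s_def)
      show "AE x in M. (\<lambda>n. s n x) \<longlonglongrightarrow> indicator ?U x"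
        unfolding s_def by (rule AE_I2) (rule LIMSEQ_indicator_UN)
    qed
    show ?case
    proof (rule spans_approximately_limit[OF E])
      show "square_integrable M (indicator ?U)"
        using A by (intro square_integrable_indicator) auto
      fix \<epsilon> :: real assume "\<epsilon> > 0"
      then obtain n where "sqnorm M (\<lambda>x. indicator ?U x - s n x) < \<epsilon>"
        using eventually_happens'[OF sequentially_bot order_tendstoD(2)[OF conv \<open>\<epsilon> > 0\<close>]] by auto
      moreover have "spans_approximately M E (s n)"
        unfolding s_sum using union(3) A by (intro spans_approximately_sum E conjI square_integrable_indicator)
      ultimately show "\<exists>g. square_integrable M g \<and> spans_approximately M E g \<and>
          sqnorm M (\<lambda>x. indicator ?U x - g x) < \<epsilon>"
        using sq by blast
    qed
  qed
qed

text \<open>Simple functions dominated by \<open>2|f|\<close> converge to \<open>f\<close> pointwise, hence in \<open>L\<^sup>2\<close> by dominated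
  convergence.\<close>

lemma (in finite_measure) spans_approximately_square_integrable:
  assumes E: "E \<subseteq> L2 M"
    and ind: "\<And>A. A \<in> sets M \<Longrightarrow> spans_approximately M E (indicator A)"
    and f: "square_integrable M f"
  shows "spans_approximately M E f"
proof -
  obtain s where s: "\<And>i. simple_function M (s i)" "\<And>x. x \<in> space M \<Longrightarrow> (\<lambda>i. s i x) \<longlonglongrightarrow> f x"
      "\<And>i x. x \<in> space M \<Longrightarrow> cmod (s i x) \<le> 2 * cmod (f x)"
    using borel_measurable_implies_sequence_metric[OF square_integrable_measurable[OF f], of 0]
    unfolding norm_conv_dist by metis
  have smeas[measurable]: "s i \<in> borel_measurable M" for i
    by (rule borel_measurable_simple_function[OF s(1)])
  have bound: "(cmod (f x - s i x))\<^sup>2 \<le> 9 * (cmod (f x))\<^sup>2" if "x \<in> space M" for i x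
  proof -
    have "cmod (f x - s i x) \<le> 3 * cmod (f x)"
      using norm_triangle_ineq4[of "f x" "s i x"] s(3)[OF that, of i] by simp
    then have "(cmod (f x - s i x))\<^sup>2 \<le> (3 * cmod (f x))\<^sup>2"
      by (rule power_mono) simp
    then show ?thesis by (simp add: power_mult_distrib)
  qed
  have conv: "(\<lambda>n. sqnorm M (\<lambda>x. f x - s n x)) \<longlonglongrightarrow> 0"
    by (rule sqnorm_diff_tendsto_0[where w = "\<lambda>x. 9 * (cmod (f x))\<^sup>2"])
      (use f s(2) bound in \<open>auto simp: square_integrable_def\<close>)
  show ?thesis
  proof (rule spans_approximately_limit[OF E f])
    fix \<epsilon> :: real assume "\<epsilon> > 0"
    then obtain n where n: "sqnorm M (\<lambda>x. f x - s n x) < \<epsilon>"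
      using eventually_happens'[OF sequentially_bot order_tendstoD(2)[OF conv \<open>\<epsilon> > 0\<close>]] by auto
    define g where "g = (\<lambda>x. \<Sum>y\<in>s n ` space M. y * indicator (s n -` {y} \<inter> space M) x)"
    have gs: "g x = s n x" if "x \<in> space M" for x
    proof -
      have "g x = (\<Sum>y\<in>{s n x}. y * indicator (s n -` {y} \<inter> space M) x)"
        unfolding g_def using that simple_functionD(1)[OF s(1)]
        by (intro sum.mono_neutral_right) (auto simp: indicator_def)
      then show ?thesis using that by simp
    qed
    have sets: "s n -` {y} \<inter> space M \<in> sets M" for y
      using s(1) by (rule simple_functionD(2))
    have "square_integrable M g" "spans_approximately M E g"
      unfolding g_def
      by (intro square_integrable_sum square_integrable_indicator sets)
        (intro spans_approximately_sum E conjI square_integrable_indicator sets ind)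
    moreover have "sqnorm M (\<lambda>x. f x - g x) < \<epsilon>"
    proof -
      have "sqnorm M (\<lambda>x. f x - g x) = sqnorm M (\<lambda>x. f x - s n x)"
        unfolding sqnorm_def by (rule Bochner_Integration.integral_cong) (auto simp: gs)
      with n show ?thesis by simp
    qed
    ultimately show "\<exists>g. square_integrable M g \<and> spans_approximately M E g \<and> sqnorm M (\<lambda>x. f x - g x) < \<epsilon>"
      by blast
  qed
qed

definition orthonormal_set :: "'a measure \<Rightarrow> 'a fclass set \<Rightarrow> bool" where
  "orthonormal_set M E \<longleftrightarrow> E \<subseteq> L2 M \<and>
     (\<forall>e\<in>E. \<forall>e'\<in>E. fun_inner M (rep e) (rep e') = (if e = e' then 1 else 0))"

lemma L2_inner_eq: "L2_inner M F G = fun_inner M (rep F) (rep G)"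
  by (simp add: L2_inner_def fun_inner_def)

lemma L2_norm_eq: "L2_norm M F = sqrt (sqnorm M (rep F))"
  by (simp add: L2_norm_def sqnorm_def)

lemma onb_iff:
  "onb M E \<longleftrightarrow> orthonormal_set M E \<and> (\<forall>F\<in>L2 M. spans_approximately M E (rep F))"
proof -
  have norm: "L2_norm M (ae_class M (\<lambda>x. rep F x - (\<Sum>e\<in>S. c e * rep e x))) =
      sqrt (sqnorm M (\<lambda>x. rep F x - (\<Sum>e\<in>S. c e * rep e x)))"
    if "E \<subseteq> L2 M" "F \<in> L2 M" "S \<subseteq> E" for F S c
  proof -
    have [measurable]: "(\<lambda>x. rep F x - (\<Sum>e\<in>S. c e * rep e x)) \<in> borel_measurable M"
      by (intro square_integrable_measurable square_integrable_diff L2_rep that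
          square_integrable_combination[OF that(1)])
    show ?thesis
      unfolding L2_norm_eq by (intro arg_cong[where f = sqrt] sqnorm_cong_AE rep_ae_class) measurable
  qed
  have "(\<forall>\<epsilon>>0. \<exists>S c. finite S \<and> S \<subseteq> E \<and>
        L2_norm M (ae_class M (\<lambda>x. rep F x - (\<Sum>e\<in>S. c e * rep e x))) < \<epsilon>) \<longleftrightarrow>
      spans_approximately M E (rep F)" (is "?L \<longleftrightarrow> _")
    if "E \<subseteq> L2 M" "F \<in> L2 M" for F
  proof
    assume L: ?L
    show "spans_approximately M E (rep F)"
      unfolding spans_approximately_def
    proof (intro allI impI)
      fix \<epsilon> :: real assume "\<epsilon> > 0"
      then obtain S c where S: "finite S" "S \<subseteq> E"
          "L2_norm M (ae_class M (\<lambda>x. rep F x - (\<Sum>e\<in>S. c e * rep e x))) < sqrt \<epsilon>"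
        using L by (meson real_sqrt_gt_zero)
      then show "\<exists>S c. finite S \<and> S \<subseteq> E \<and> sqnorm M (\<lambda>x. rep F x - (\<Sum>e\<in>S. c e * rep e x)) < \<epsilon>"
        by (auto simp: norm[OF that])
    qed
  next
    assume R: "spans_approximately M E (rep F)"
    show ?L
    proof (intro allI impI)
      fix \<epsilon> :: real assume "\<epsilon> > 0"
      then obtain S c where S: "finite S" "S \<subseteq> E"
          "sqnorm M (\<lambda>x. rep F x - (\<Sum>e\<in>S. c e * rep e x)) < \<epsilon>\<^sup>2"
        using R unfolding spans_approximately_def by (meson zero_less_power)
      then have "sqrt (sqnorm M (\<lambda>x. rep F x - (\<Sum>e\<in>S. c e * rep e x))) < sqrt (\<epsilon>\<^sup>2)"
        using real_sqrt_less_mono by blast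
      then show "\<exists>S c. finite S \<and> S \<subseteq> E \<and>
          L2_norm M (ae_class M (\<lambda>x. rep F x - (\<Sum>e\<in>S. c e * rep e x))) < \<epsilon>"
        using S \<open>\<epsilon> > 0\<close> by (intro exI[of _ S] exI[of _ c]) (simp add: norm[OF that])
    qed
  qed
  then show ?thesis
    unfolding onb_def orthonormal_set_def L2_inner_eq by blast
qed

text \<open>Up to a null set, either \<open>v\<close> already is a combination of \<open>S\<close>, or its normalized component orthogonal to \<open>S\<close> is added.\<close>

lemma Gram_Schmidt_step:
  assumes S: "finite S" "orthonormal_set M S" and v: "square_integrable M v"
  shows "\<exists>T c. finite T \<and> orthonormal_set M T \<and> S \<subseteq> T \<and> (AE x in M. v x = (\<Sum>e\<in>T. c e * rep e x))"
proof -
  have SL: "S \<subseteq> L2 M" and orth: "\<And>e e'. e \<in> S \<Longrightarrow> e' \<in> S \<Longrightarrow>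
      fun_inner M (rep e) (rep e') = (if e = e' then 1 else 0)"
    using S(2) by (auto simp: orthonormal_set_def)
  let ?c = "\<lambda>e. fun_inner M (rep e) v"
  define r where "r = (\<lambda>x. v x - (\<Sum>e\<in>S. ?c e * rep e x))"
  have r: "square_integrable M r"
    unfolding r_def by (intro square_integrable_diff v square_integrable_combination[OF SL]) simp
  have perp: "fun_inner M (rep e) r = 0" if "e \<in> S" for e
    unfolding r_def by (rule best_approximation(2)[OF S(1) _ v orth that]) (use SL L2_rep in auto)
  show ?thesis
  proof (cases "sqnorm M r = 0")
    case True
    then have "AE x in M. r x = 0"
      by (simp add: sqnorm_eq_0_iff[OF r])
    then have "AE x in M. v x = (\<Sum>e\<in>S. ?c e * rep e x)"
      by eventually_elim (simp add: r_def)
    with S show ?thesis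
      by (intro exI[of _ S] exI[of _ ?c]) simp
  next
    case False
    define n where "n = sqrt (sqnorm M r)"
    have n: "n > 0" "n\<^sup>2 = sqnorm M r"
      using False by (auto simp: n_def order_less_le)
    let ?u = "\<lambda>x. of_real (1 / n) * r x"
    have u: "square_integrable M ?u"
      by (rule square_integrable_scale[OF r])
    define e0 where "e0 = ae_class M ?u"
    have e0: "e0 \<in> L2 M"
      unfolding e0_def by (rule square_integrable_ae_class_L2[OF u])
    have re: "rep e0 \<in> borel_measurable M" "AE x in M. rep e0 x = ?u x"
      unfolding e0_def by (rule rep_ae_class[OF square_integrable_measurable[OF u]])+
    have inner: "fun_inner M (rep e) (rep e0) = 0" if "e \<in> S" for e
    proof -
      have "rep e \<in> borel_measurable M"
        using that SL by (intro square_integrable_measurable L2_rep(1)) auto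
      then have "fun_inner M (rep e) (rep e0) = fun_inner M (rep e) ?u"
        using re square_integrable_measurable[OF u] by (intro fun_inner_cong_AE) auto
      then show ?thesis
        unfolding fun_inner_scale_right perp[OF that] by simp
    qed
    then have inner': "fun_inner M (rep e0) (rep e) = 0" if "e \<in> S" for e
      using that by (simp add: fun_inner_commute[of M "rep e0" "rep e"])
    have norm: "fun_inner M (rep e0) (rep e0) = 1"
    proof -
      have "sqnorm M (rep e0) = sqnorm M ?u"
        by (rule sqnorm_cong_AE[OF re(1) square_integrable_measurable[OF u] re(2)])
      also have "\<dots> = 1"
        unfolding sqnorm_scale n(2)[symmetric] using n(1) by (simp add: norm_divide power_divide)
      finally show ?thesis
        by (simp add: fun_inner_self)
    qed
    have notin: "e0 \<notin> S"
      using inner norm by fastforce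
    have orth': "orthonormal_set M (insert e0 S)"
      unfolding orthonormal_set_def
      using SL e0 orth inner inner' norm notin by auto
    have "AE x in M. v x = (\<Sum>e\<in>insert e0 S. (?c(e0 := of_real n)) e * rep e x)"
      using re(2)
    proof eventually_elim
      case (elim x)
      have "(\<Sum>e\<in>S. (?c(e0 := of_real n)) e * rep e x) = (\<Sum>e\<in>S. ?c e * rep e x)"
        using notin by (intro sum.cong) auto
      then show ?case
        using S(1) notin elim n(1) by (simp add: r_def)
    qed
    then show ?thesis
      using S(1) orth' by (intro exI[of _ "insert e0 S"] exI[of _ "?c(e0 := of_real n)"]) auto
  qed
qed

text \<open>The orthonormal set is the union of an increasing chain of finite ones; a function that a member
  of the chain represents stays in the span of the union.\<close>

lemma Gram_Schmidt:
  assumes v: "\<And>n :: nat. square_integrable M (v n)"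
  shows "\<exists>E. orthonormal_set M E \<and> (\<forall>n. spans_approximately M E (v n))"
proof -
  have "\<exists>S. \<forall>n. (finite (S n) \<and> orthonormal_set M (S n)) \<and>
      (S n \<subseteq> S (Suc n) \<and> (\<exists>c. AE x in M. v n x = (\<Sum>e\<in>S (Suc n). c e * rep e x)))"
  proof (rule dependent_nat_choice)
    show "\<exists>S. finite S \<and> orthonormal_set M S"
      by (rule exI[of _ "{}"]) (simp add: orthonormal_set_def)
    show "\<exists>T. (finite T \<and> orthonormal_set M T) \<and>
        S \<subseteq> T \<and> (\<exists>c. AE x in M. v n x = (\<Sum>e\<in>T. c e * rep e x))"
      if "finite S \<and> orthonormal_set M S" for S n
      using Gram_Schmidt_step[of S M "v n"] that v by blast
  qed
  then obtain S where S: "\<And>n. finite (S n)" "\<And>n. orthonormal_set M (S n)" "\<And>n. S n \<subseteq> S (Suc n)"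
      "\<And>n. \<exists>c. AE x in M. v n x = (\<Sum>e\<in>S (Suc n). c e * rep e x)"
    by blast
  define E where "E = (\<Union>n. S n)"
  have mono: "S m \<subseteq> S n" if "m \<le> n" for m n
    using that S(3) by (rule lift_Suc_mono_le[rotated])
  have E: "orthonormal_set M E"
    unfolding orthonormal_set_def
  proof (intro conjI ballI)
    show "E \<subseteq> L2 M"
      using S(2) by (auto simp: E_def orthonormal_set_def)
    fix e e' assume "e \<in> E" "e' \<in> E"
    then obtain m n where "e \<in> S m" "e' \<in> S n"
      by (auto simp: E_def)
    then have "e \<in> S (max m n)" "e' \<in> S (max m n)"
      using mono[of m "max m n"] mono[of n "max m n"] by auto
    then show "fun_inner M (rep e) (rep e') = (if e = e' then 1 else 0)"
      using S(2)[of "max m n"] unfolding orthonormal_set_def by blast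
  qed
  have "spans_approximately M E (v n)" for n
  proof -
    obtain c where "AE x in M. v n x = (\<Sum>e\<in>S (Suc n). c e * rep e x)"
      using S(4) by blast
    then show ?thesis
      using E S(1) v by (intro spans_approximately_combination[where S = "S (Suc n)"])
        (auto simp: E_def orthonormal_set_def square_integrable_measurable)
  qed
  with E show ?thesis by blast
qed

text \<open>Finite intersections of a countable basis of the topology; the empty intersection contributes the whole space.\<close>

lemma countable_generating_Int_stable:
  obtains G :: "'a::second_countable_topology set set"
  where "countable G" "Int_stable G" "UNIV \<in> G" "sets borel = sigma_sets UNIV G"
proof -
  obtain B :: "'a set set" where B: "countable B" "topological_basis B"
    using ex_countable_basis by blast
  define G where "G = Inter ` {F. finite F \<and> F \<subseteq> B}"
  have "countable G"
    unfolding G_def by (intro countable_image countable_Collect_finite_subset B)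
  moreover have "Int_stable G"
  proof (rule Int_stableI)
    fix a b assume "a \<in> G" "b \<in> G"
    then obtain F F' where "a = \<Inter>F" "b = \<Inter>F'" "finite F" "F \<subseteq> B" "finite F'" "F' \<subseteq> B"
      by (auto simp: G_def)
    then show "a \<inter> b \<in> G"
      unfolding G_def by (intro image_eqI[of _ _ "F \<union> F'"]) auto
  qed
  moreover have "UNIV \<in> G"
    unfolding G_def by (intro image_eqI[of _ _ "{}"]) auto
  moreover have "sets borel = sigma_sets UNIV G"
  proof -
    have "sigma_sets UNIV B = sigma_sets UNIV G"
    proof (rule sigma_sets_eqI)
      fix b assume "b \<in> B"
      then have "b \<in> G"
        unfolding G_def by (intro image_eqI[of _ _ "{b}"]) auto
      then show "b \<in> sigma_sets UNIV G" by (rule sigma_sets.Basic)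
    next
      fix g assume "g \<in> G"
      then obtain F where F: "g = \<Inter>F" "finite F" "F \<subseteq> B"
        by (auto simp: G_def)
      have "open g"
        unfolding F(1) using F(2,3) topological_basis_open[OF B(2)] by (intro open_Inter) auto
      then have "g \<in> sets borel" by simp
      then show "g \<in> sigma_sets UNIV B"
        by (simp add: borel_eq_countable_basis[OF B])
    qed
    then show ?thesis
      by (simp add: borel_eq_countable_basis[OF B])
  qed
  ultimately show ?thesis
    by (rule that)
qed

text \<open>The trace is computed in an orthonormal basis picked by Hilbert choice, so it means something only if a
  basis exists. Orthonormalizing the indicators of a countable generating \<open>\<pi>\<close>-system yields one.\<close>

lemma onb_exists:
  fixes M :: "'a::second_countable_topology measure"
  assumes "finite_measure M" "sets M = sets borel"
  shows "\<exists>E. onb M E"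
proof -
  interpret finite_measure M by (rule assms(1))
  obtain G :: "'a set set" where G: "countable G" "Int_stable G" "UNIV \<in> G" "sets borel = sigma_sets UNIV G"
    by (rule countable_generating_Int_stable)
  have space: "space M = UNIV"
    using sets_eq_imp_space_eq[OF assms(2)] by simp
  have "range (from_nat_into G) = G"
    using G(1,3) by (intro range_from_nat_into) auto
  have GM: "A \<in> sets M" if "A \<in> G" for A
    using that by (simp add: assms(2) G(4) sigma_sets.Basic)
  have "\<exists>E. orthonormal_set M E \<and> (\<forall>n. spans_approximately M E (indicator (from_nat_into G n)))"
    by (rule Gram_Schmidt) (use GM G(3) in \<open>auto intro!: square_integrable_indicator from_nat_into\<close>)
  then obtain E where E: "orthonormal_set M E"
      "\<And>n. spans_approximately M E (indicator (from_nat_into G n))"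
    by blast
  then have EL: "E \<subseteq> L2 M"
    by (simp add: orthonormal_set_def)
  have basic: "spans_approximately M E (indicator A)" if A: "A \<in> G" for A
    using E(2) A \<open>range (from_nat_into G) = G\<close> by (metis imageE)
  have "spans_approximately M E (indicator A)" if "A \<in> sets M" for A
  proof (rule spans_approximately_indicator[OF EL _ G(2) _ _ basic that])
    show "sets M = sigma_sets (space M) G"
      by (simp only: space assms(2) G(4))
  qed (simp_all add: space G(3))
  then have "spans_approximately M E (rep F)" if "F \<in> L2 M" for F
    by (rule spans_approximately_square_integrable[OF EL _ L2_rep(1)[OF that]])
  with E(1) show ?thesis
    by (auto simp: onb_iff)
qed


section \<open>Calculus of almost-everywhere classes\<close>

text \<open>The classes of measurable functions. On them \<open>rep\<close> and \<open>ae_class\<close> are mutually inverse up to null sets,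
  so every identity between classes reduces to an almost-everywhere identity between representatives.\<close>

definition measurable_classes :: "'a measure \<Rightarrow> 'a fclass set" where
  "measurable_classes M = ae_class M ` borel_measurable M"

lemma ae_class_measurable_classes: "f \<in> borel_measurable M \<Longrightarrow> ae_class M f \<in> measurable_classes M"
  by (simp add: measurable_classes_def)

lemma measurable_classes_rep:
  assumes "F \<in> measurable_classes M"
  shows "rep F \<in> borel_measurable M" "ae_class M (rep F) = F"
proof -
  obtain f where f: "F = ae_class M f" "f \<in> borel_measurable M"
    using assms by (auto simp: measurable_classes_def)
  show "rep F \<in> borel_measurable M" "ae_class M (rep F) = F"
    unfolding f(1) by (rule rep_ae_class[OF f(2)], rule ae_class_eqI[OF rep_ae_class(2)[OF f(2)]])
qed

lemma class_eqI:
  assumes "F \<in> measurable_classes M" "G \<in> measurable_classes M" "AE x in M. rep F x = rep G x"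
  shows "F = G"
  using ae_class_eqI[OF assms(3)] by (simp add: measurable_classes_rep assms)

lemma L2_iff: "F \<in> L2 M \<longleftrightarrow> F \<in> measurable_classes M \<and> square_integrable M (rep F)"
proof
  assume "F \<in> L2 M"
  then show "F \<in> measurable_classes M \<and> square_integrable M (rep F)"
    using L2_rep[of F M] ae_class_measurable_classes[OF square_integrable_measurable] by metis
next
  assume F: "F \<in> measurable_classes M \<and> square_integrable M (rep F)"
  then show "F \<in> L2 M"
    using square_integrable_ae_class_L2[of M "rep F"] measurable_classes_rep(2)[of F M] by simp
qed

lemma L2_measurable_classes: "F \<in> L2 M \<Longrightarrow> F \<in> measurable_classes M"
  by (simp add: L2_iff)

lemma Linf_iff:
  "F \<in> Linf M \<longleftrightarrow> F \<in> measurable_classes M \<and> (\<exists>C. AE x in M. cmod (rep F x) \<le> C)"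
proof
  assume "F \<in> Linf M"
  then obtain f C where f: "F = ae_class M f" "f \<in> borel_measurable M" "AE x in M. cmod (f x) \<le> C"
    by (auto simp: Linf_def)
  have "AE x in M. cmod (rep F x) \<le> C"
    using f(3) rep_ae_class(2)[OF f(2)] unfolding f(1) by eventually_elim simp
  then show "F \<in> measurable_classes M \<and> (\<exists>C. AE x in M. cmod (rep F x) \<le> C)"
    using f(1,2) by (auto simp: measurable_classes_def)
next
  assume F: "F \<in> measurable_classes M \<and> (\<exists>C. AE x in M. cmod (rep F x) \<le> C)"
  then show "F \<in> Linf M"
    using measurable_classes_rep[of F M] unfolding Linf_def by (intro CollectI exI[of _ "rep F"]) auto
qed

lemma L1_iff: "F \<in> L1 M \<longleftrightarrow> F \<in> measurable_classes M \<and> integrable M (rep F)"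
proof
  assume "F \<in> L1 M"
  then show "F \<in> measurable_classes M \<and> integrable M (rep F)"
    using L1_rep[of F M] ae_class_measurable_classes[OF borel_measurable_integrable] by metis
next
  assume "F \<in> measurable_classes M \<and> integrable M (rep F)"
  then show "F \<in> L1 M"
    using measurable_classes_rep[of F M] unfolding L1_def by (intro CollectI exI[of _ "rep F"]) auto
qed

lemma rep_cl_add:
  assumes "F \<in> measurable_classes M" "G \<in> measurable_classes M"
  shows "cl_add M F G \<in> measurable_classes M" "AE x in M. rep (cl_add M F G) x = rep F x + rep G x"
proof -
  note [measurable] = measurable_classes_rep(1)[OF assms(1)] measurable_classes_rep(1)[OF assms(2)]
  show "cl_add M F G \<in> measurable_classes M"
    unfolding cl_add_def by (rule ae_class_measurable_classes) measurable
  show "AE x in M. rep (cl_add M F G) x = rep F x + rep G x"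
    unfolding cl_add_def by (rule rep_ae_class) measurable
qed

lemma rep_cl_mult:
  assumes "F \<in> measurable_classes M" "G \<in> measurable_classes M"
  shows "cl_mult M F G \<in> measurable_classes M" "AE x in M. rep (cl_mult M F G) x = rep F x * rep G x"
proof -
  note [measurable] = measurable_classes_rep(1)[OF assms(1)] measurable_classes_rep(1)[OF assms(2)]
  show "cl_mult M F G \<in> measurable_classes M"
    unfolding cl_mult_def by (rule ae_class_measurable_classes) measurable
  show "AE x in M. rep (cl_mult M F G) x = rep F x * rep G x"
    unfolding cl_mult_def by (rule rep_ae_class) measurable
qed

lemma rep_cl_scale:
  assumes "F \<in> measurable_classes M"
  shows "cl_scale M c F \<in> measurable_classes M" "AE x in M. rep (cl_scale M c F) x = c * rep F x"
proof -
  note [measurable] = measurable_classes_rep(1)[OF assms(1)]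
  show "cl_scale M c F \<in> measurable_classes M"
    unfolding cl_scale_def by (rule ae_class_measurable_classes) measurable
  show "AE x in M. rep (cl_scale M c F) x = c * rep F x"
    unfolding cl_scale_def by (rule rep_ae_class) measurable
qed

lemma rep_cl_cnj:
  assumes "F \<in> measurable_classes M"
  shows "cl_cnj M F \<in> measurable_classes M" "AE x in M. rep (cl_cnj M F) x = cnj (rep F x)"
proof -
  note [measurable] = measurable_classes_rep(1)[OF assms(1)]
  show "cl_cnj M F \<in> measurable_classes M"
    unfolding cl_cnj_def by (rule ae_class_measurable_classes) measurable
  show "AE x in M. rep (cl_cnj M F) x = cnj (rep F x)"
    unfolding cl_cnj_def by (rule rep_ae_class) measurable
qed

lemma L2_closed:
  assumes "F \<in> L2 M"
  shows "G \<in> L2 M \<Longrightarrow> cl_add M F G \<in> L2 M" "cl_scale M c F \<in> L2 M"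
  unfolding cl_add_def cl_scale_def
  by (intro square_integrable_ae_class_L2 square_integrable_add square_integrable_scale L2_rep(1) assms; assumption)+


section \<open>Bounded operators, adjoints and the trace\<close>

lemma BH_closed: "A \<in> BH M \<Longrightarrow> F \<in> L2 M \<Longrightarrow> A F \<in> L2 M"
  unfolding BH_def by blast

lemma BH_add:
  "A \<in> BH M \<Longrightarrow> F \<in> L2 M \<Longrightarrow> G \<in> L2 M \<Longrightarrow> A (cl_add M F G) = cl_add M (A F) (A G)"
  by (simp add: BH_def)

lemma BH_scale: "A \<in> BH M \<Longrightarrow> F \<in> L2 M \<Longrightarrow> A (cl_scale M c F) = cl_scale M c (A F)"
  by (simp add: BH_def)

lemma BH_extensionality:
  assumes "A \<in> BH M" "B \<in> BH M" "\<And>F. F \<in> L2 M \<Longrightarrow> A F = B F"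
  shows "A = B"
  using assms unfolding BH_def by (intro PiE_ext[of A "L2 M" "\<lambda>_. L2 M" B]) auto

lemma BH_bound:
  assumes "A \<in> BH M"
  shows "\<exists>C\<ge>0. \<forall>F\<in>L2 M. sqnorm M (rep (A F)) \<le> C * sqnorm M (rep F)"
proof -
  obtain C where C: "\<And>F. F \<in> L2 M \<Longrightarrow> L2_norm M (A F) \<le> C * L2_norm M F"
    using assms unfolding BH_def by blast
  have "sqnorm M (rep (A F)) \<le> C\<^sup>2 * sqnorm M (rep F)" if "F \<in> L2 M" for F
  proof -
    have "(sqrt (sqnorm M (rep (A F))))\<^sup>2 \<le> (C * sqrt (sqnorm M (rep F)))\<^sup>2"
      using C[OF that] unfolding L2_norm_eq by (rule power_mono) simp
    then show ?thesis
      by (simp add: power_mult_distrib)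
  qed
  then show ?thesis
    by (intro exI[of _ "C\<^sup>2"]) simp
qed

lemma BH_I:
  assumes maps: "A \<in> L2 M \<rightarrow>\<^sub>E L2 M"
    and "\<And>F G. F \<in> L2 M \<Longrightarrow> G \<in> L2 M \<Longrightarrow> A (cl_add M F G) = cl_add M (A F) (A G)"
    and "\<And>c F. F \<in> L2 M \<Longrightarrow> A (cl_scale M c F) = cl_scale M c (A F)"
    and bound: "\<And>F. F \<in> L2 M \<Longrightarrow> sqnorm M (rep (A F)) \<le> C * sqnorm M (rep F)"
  shows "A \<in> BH M"
proof -
  have "L2_norm M (A F) \<le> sqrt C * L2_norm M F" if "F \<in> L2 M" for F
    using real_sqrt_le_mono[OF bound[OF that]] by (simp add: L2_norm_eq real_sqrt_mult)
  then show ?thesis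
    unfolding BH_def using assms(1-3)
    by (intro CollectI conjI ballI allI exI[of _ "sqrt C"]) simp_all
qed

lemma compose_BH:
  assumes A: "A \<in> BH M" and B: "B \<in> BH M"
  shows "compose (L2 M) A B \<in> BH M"
proof -
  obtain C where C: "C \<ge> 0" "\<And>F. F \<in> L2 M \<Longrightarrow> sqnorm M (rep (A F)) \<le> C * sqnorm M (rep F)"
    using BH_bound[OF A] by blast
  obtain D where D: "\<And>F. F \<in> L2 M \<Longrightarrow> sqnorm M (rep (B F)) \<le> D * sqnorm M (rep F)"
    using BH_bound[OF B] by blast
  show ?thesis
  proof (rule BH_I[where C = "C * D"])
    show "compose (L2 M) A B \<in> L2 M \<rightarrow>\<^sub>E L2 M"
      using A B by (auto simp: compose_def BH_closed)
    fix F assume F: "F \<in> L2 M"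
    show "compose (L2 M) A B (cl_add M F G) = cl_add M (compose (L2 M) A B F) (compose (L2 M) A B G)"
      if "G \<in> L2 M" for G
      using F that by (simp add: compose_def L2_closed BH_closed[OF B] BH_add[OF A] BH_add[OF B])
    show "compose (L2 M) A B (cl_scale M c F) = cl_scale M c (compose (L2 M) A B F)" for c
      using F by (simp add: compose_def L2_closed BH_closed[OF B] BH_scale[OF A] BH_scale[OF B])
    have "sqnorm M (rep (A (B F))) \<le> C * sqnorm M (rep (B F))"
      by (rule C(2)[OF BH_closed[OF B F]])
    also have "\<dots> \<le> C * (D * sqnorm M (rep F))"
      by (rule mult_left_mono[OF D[OF F] C(1)])
    finally show "sqnorm M (rep (compose (L2 M) A B F)) \<le> C * D * sqnorm M (rep F)"
      using F by (simp add: compose_def mult.assoc)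
  qed
qed

text \<open>Linearity is a statement about classes; this is its form for finite combinations of representatives.\<close>

lemma BH_combination:
  assumes A: "A \<in> BH M" and "S \<subseteq> L2 M" "finite S"
  shows "AE x in M. rep (A (ae_class M (\<lambda>x. \<Sum>e\<in>S. c e * rep e x))) x = (\<Sum>e\<in>S. c e * rep (A e) x)"
  using assms(3,2)
proof (induction S)
  case empty
  let ?z = "ae_class M (\<lambda>x. 0) :: 'a fclass"
  have z: "?z \<in> L2 M"
    by (rule square_integrable_ae_class_L2) simp
  have "cl_scale M 0 ?z = ?z"
    by (simp add: cl_scale_def)
  then have "A ?z = cl_scale M 0 (A ?z)"
    using BH_scale[OF A z, of 0] by simp
  then show ?case
    using rep_cl_scale(2)[OF L2_measurable_classes[OF BH_closed[OF A z]], of 0] by simp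
next
  case (insert e S)
  define s where "s = (\<lambda>x. \<Sum>e\<in>S. c e * rep e x)"
  have e: "e \<in> L2 M" and SL: "S \<subseteq> L2 M"
    using insert.prems by auto
  have s: "square_integrable M s"
    unfolding s_def by (rule square_integrable_combination[OF SL]) simp
  note sL = square_integrable_ae_class_L2[OF s]
  have sc: "cl_scale M (c e) e \<in> L2 M"
    by (rule L2_closed(2)[OF e])
  have "ae_class M (\<lambda>x. c e * rep e x + s x) = cl_add M (cl_scale M (c e) e) (ae_class M s)"
    unfolding cl_add_def
    by (rule ae_class_eqI)
      (use rep_cl_scale(2)[OF L2_measurable_classes[OF e], of "c e"]
        rep_ae_class(2)[OF square_integrable_measurable[OF s]] in \<open>eventually_elim, simp\<close>)
  then have eq: "A (ae_class M (\<lambda>x. c e * rep e x + s x)) = cl_add M (cl_scale M (c e) (A e)) (A (ae_class M s))"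
    using e sc sL by (simp add: BH_add[OF A] BH_scale[OF A])
  have "AE x in M. rep (A (ae_class M s)) x = (\<Sum>e\<in>S. c e * rep (A e) x)"
    unfolding s_def by (rule insert.IH[OF SL])
  moreover have "AE x in M. rep (cl_scale M (c e) (A e)) x = c e * rep (A e) x"
    by (intro rep_cl_scale(2) L2_measurable_classes BH_closed[OF A] e)
  moreover have "AE x in M. rep (A (ae_class M (\<lambda>x. c e * rep e x + s x))) x =
      rep (cl_scale M (c e) (A e)) x + rep (A (ae_class M s)) x"
    unfolding eq by (intro rep_cl_add(2) L2_measurable_classes L2_closed BH_closed[OF A] e sL)
  moreover have "(\<lambda>x. \<Sum>e\<in>insert e S. c e * rep e x) = (\<lambda>x. c e * rep e x + s x)"
    using insert.hyps by (simp add: s_def)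
  ultimately show ?case
    using insert.hyps by (auto elim!: eventually_elim2)
qed

lemma BH_diff:
  assumes A: "A \<in> BH M" and F: "F \<in> L2 M" and G: "G \<in> L2 M"
  shows "AE x in M. rep (A (ae_class M (\<lambda>x. rep F x - rep G x))) x = rep (A F) x - rep (A G) x"
proof -
  have sc: "cl_scale M (-1) G \<in> L2 M"
    by (rule L2_closed(2)[OF G])
  have "ae_class M (\<lambda>x. rep F x - rep G x) = cl_add M F (cl_scale M (-1) G)"
    unfolding cl_add_def
    by (rule ae_class_eqI)
      (use rep_cl_scale(2)[OF L2_measurable_classes[OF G], of "-1"] in \<open>eventually_elim, simp\<close>)
  then have eq: "A (ae_class M (\<lambda>x. rep F x - rep G x)) = cl_add M (A F) (cl_scale M (-1) (A G))"
    using F G sc by (simp add: BH_add[OF A] BH_scale[OF A])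
  have "AE x in M. rep (cl_scale M (-1) (A G)) x = -1 * rep (A G) x"
    by (intro rep_cl_scale(2) L2_measurable_classes BH_closed[OF A] G)
  moreover have "AE x in M. rep (A (ae_class M (\<lambda>x. rep F x - rep G x))) x =
      rep (A F) x + rep (cl_scale M (-1) (A G)) x"
    unfolding eq by (intro rep_cl_add(2) L2_measurable_classes L2_closed BH_closed[OF A] F G)
  ultimately show ?thesis
    by eventually_elim simp
qed

lemma L2_inner_cl_scale:
  assumes "F \<in> L2 M" "G \<in> L2 M"
  shows "L2_inner M F (cl_scale M c G) = c * L2_inner M F G"
proof -
  have "L2_inner M F (cl_scale M c G) = fun_inner M (rep F) (\<lambda>x. c * rep G x)"
    unfolding L2_inner_eq
    by (rule fun_inner_cong_AE)
      (auto intro!: measurable_classes_rep(1) rep_cl_scale L2_measurable_classes L2_closed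
        borel_measurable_times assms)
  then show ?thesis
    by (simp add: fun_inner_scale_right L2_inner_eq)
qed

lemma L2_inner_commute: "L2_inner M G F = cnj (L2_inner M F G)"
  unfolding L2_inner_eq by (rule fun_inner_commute)

text \<open>The Fourier sums of \<open>\<psi>\<close> over finite \<open>S \<subseteq> E\<close> converge to \<open>\<psi>\<close>, and
  \<open>\<langle>\<psi>, A \<cdot>\<rangle>\<close> is linear and bounded, so it may be applied term by term.\<close>

lemma Parseval_operator:
  assumes E: "onb M E" and A: "A \<in> BH M" and \<psi>: "\<psi> \<in> L2 M"
  shows "((\<lambda>e. L2_inner M \<psi> (A e) * L2_inner M e \<psi>) has_sum L2_inner M \<psi> (A \<psi>)) E"
proof -
  have EL: "E \<subseteq> L2 M" and orth: "\<And>e e'. e \<in> E \<Longrightarrow> e' \<in> E \<Longrightarrow>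
      fun_inner M (rep e) (rep e') = (if e = e' then 1 else 0)"
    and dense: "spans_approximately M E (rep \<psi>)"
    using E \<psi> by (auto simp: onb_iff orthonormal_set_def)
  let ?c = "\<lambda>e. fun_inner M (rep e) (rep \<psi>)"
  let ?P = "\<lambda>S. ae_class M (\<lambda>x. \<Sum>e\<in>S. ?c e * rep e x)"
  obtain C where C: "C \<ge> 0" "\<And>F. F \<in> L2 M \<Longrightarrow> sqnorm M (rep (A F)) \<le> C * sqnorm M (rep F)"
    using BH_bound[OF A] by blast
  note sq\<psi> = L2_rep(1)[OF \<psi>]
  have P: "?P S \<in> L2 M" if "S \<subseteq> E" for S
    by (intro square_integrable_ae_class_L2 square_integrable_combination[OF EL that])
  have partial: "(\<Sum>e\<in>S. L2_inner M \<psi> (A e) * L2_inner M e \<psi>) = L2_inner M \<psi> (A (?P S))"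
    if S: "finite S" "S \<subseteq> E" for S
  proof -
    have Ae: "square_integrable M (rep (A e))" if "e \<in> S" for e
      using that S EL by (intro L2_rep(1) BH_closed[OF A]) auto
    have "L2_inner M \<psi> (A (?P S)) = fun_inner M (rep \<psi>) (\<lambda>x. \<Sum>e\<in>S. ?c e * rep (A e) x)"
      unfolding L2_inner_eq
    proof (rule fun_inner_cong_AE)
      show "AE x in M. rep (A (?P S)) x = (\<Sum>e\<in>S. ?c e * rep (A e) x)"
        using S EL by (intro BH_combination[OF A]) auto
    qed (auto intro!: square_integrable_measurable square_integrable_sum sq\<psi> Ae L2_rep(1) BH_closed[OF A] P S \<psi>
        intro: subsetD[OF EL] subsetD[OF S(2)])
    also have "\<dots> = (\<Sum>e\<in>S. ?c e * fun_inner M (rep \<psi>) (rep (A e)))"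
      by (rule fun_inner_sum_right[OF sq\<psi> Ae])
    finally show ?thesis
      by (simp add: L2_inner_eq mult.commute)
  qed
  have error: "(cmod (L2_inner M \<psi> (A \<psi>) - L2_inner M \<psi> (A (?P S))))\<^sup>2 \<le>
      sqnorm M (rep \<psi>) * (C * sqnorm M (\<lambda>x. rep \<psi> x - (\<Sum>e\<in>S. ?c e * rep e x)))"
    if S: "finite S" "S \<subseteq> E" for S
  proof -
    let ?d = "\<lambda>x. rep \<psi> x - rep (?P S) x"
    have d: "square_integrable M ?d"
      by (intro square_integrable_diff sq\<psi> L2_rep(1) P S)
    note dL = square_integrable_ae_class_L2[OF d]
    note sqs = L2_rep(1)[OF BH_closed[OF A \<psi>]] L2_rep(1)[OF BH_closed[OF A P[OF S(2)]]]
    have "L2_inner M \<psi> (A \<psi>) - L2_inner M \<psi> (A (?P S)) = fun_inner M (rep \<psi>) (\<lambda>x. rep (A \<psi>) x - rep (A (?P S)) x)"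
      unfolding L2_inner_eq by (rule fun_inner_diff_right[OF sq\<psi> sqs, symmetric])
    also have "(cmod \<dots>)\<^sup>2 \<le> sqnorm M (rep \<psi>) * sqnorm M (\<lambda>x. rep (A \<psi>) x - rep (A (?P S)) x)"
      by (intro Cauchy_Schwarz_fun_inner sq\<psi> square_integrable_diff sqs)
    also have "sqnorm M (\<lambda>x. rep (A \<psi>) x - rep (A (?P S)) x) = sqnorm M (rep (A (ae_class M ?d)))"
    proof (rule sqnorm_cong_AE)
      show "AE x in M. rep (A \<psi>) x - rep (A (?P S)) x = rep (A (ae_class M ?d)) x"
        using BH_diff[OF A \<psi> P[OF S(2)]] by eventually_elim simp
    qed (auto intro!: square_integrable_measurable square_integrable_diff sqs L2_rep(1) BH_closed[OF A] dL)
    also have "\<dots> \<le> C * sqnorm M (rep (ae_class M ?d))"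
      by (rule C(2)[OF dL])
    also have "sqnorm M (rep (ae_class M ?d)) = sqnorm M (\<lambda>x. rep \<psi> x - (\<Sum>e\<in>S. ?c e * rep e x))"
    proof (rule sqnorm_cong_AE)
      show "AE x in M. rep (ae_class M ?d) x = rep \<psi> x - (\<Sum>e\<in>S. ?c e * rep e x)"
        using rep_ae_class(2)[OF square_integrable_measurable[OF d]]
          rep_ae_class(2)[OF square_integrable_measurable[OF square_integrable_combination[OF EL S(2)]], of ?c]
        by eventually_elim simp
    qed (auto intro!: square_integrable_measurable square_integrable_diff square_integrable_combination[OF EL S(2)]
        sq\<psi> L2_rep(1) dL)
    finally show ?thesis
      by (simp add: mult_left_mono)
  qed
  show ?thesis
    unfolding has_sum_def
  proof (rule tendstoI)
    fix \<epsilon> :: real assume \<epsilon>: "\<epsilon> > 0"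
    \<comment> \<open>The summand \<open>1\<close> keeps the factor positive when \<open>\<psi>\<close> or the bound of \<open>A\<close> vanishes.\<close>
    define K where "K = sqnorm M (rep \<psi>) * C + 1"
    have K: "K > 0"
      using C(1) by (simp add: K_def add_nonneg_pos)
    obtain S0 c where S0: "finite S0" "S0 \<subseteq> E"
        "sqnorm M (\<lambda>x. rep \<psi> x - (\<Sum>e\<in>S0. c e * rep e x)) < \<epsilon>\<^sup>2 / K"
      using dense \<epsilon> K unfolding spans_approximately_def by (meson divide_pos_pos zero_less_power)
    show "\<forall>\<^sub>F S in finite_subsets_at_top E.
        dist (\<Sum>e\<in>S. L2_inner M \<psi> (A e) * L2_inner M e \<psi>) (L2_inner M \<psi> (A \<psi>)) < \<epsilon>"
      unfolding eventually_finite_subsets_at_top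
    proof (intro exI[of _ S0] conjI allI impI)
      fix S assume "finite S \<and> S0 \<subseteq> S \<and> S \<subseteq> E"
      then have S: "finite S" "S0 \<subseteq> S" "S \<subseteq> E" by auto
      \<comment> \<open>A good approximation over \<open>S0\<close> is one over \<open>S\<close>, and the Fourier sum over \<open>S\<close> is the best there.\<close>
      let ?b = "\<lambda>e. if e \<in> S0 then c e else 0"
      let ?r = "sqnorm M (\<lambda>x. rep \<psi> x - (\<Sum>e\<in>S. ?c e * rep e x))"
      have "square_integrable M (rep e)" if "e \<in> S" for e
        using that S(3) EL by (intro L2_rep(1)) auto
      moreover have "fun_inner M (rep e) (rep e') = (if e = e' then 1 else 0)" if "e \<in> S" "e' \<in> S" for e e'
        using that S(3) by (intro orth) auto
      ultimately have "?r \<le> sqnorm M (\<lambda>x. rep \<psi> x - (\<Sum>e\<in>S. ?b e * rep e x))"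
        using best_approximation(1)[OF S(1), where u = rep and f = "rep \<psi>" and c = ?b and M = M] sq\<psi>
        by blast
      moreover have "(\<lambda>x. \<Sum>e\<in>S. ?b e * rep e x) = (\<lambda>x. \<Sum>e\<in>S0. c e * rep e x)"
      proof
        fix x show "(\<Sum>e\<in>S. ?b e * rep e x) = (\<Sum>e\<in>S0. c e * rep e x)"
          using S(1,2) by (intro sum.mono_neutral_cong_right) auto
      qed
      ultimately have r: "?r < \<epsilon>\<^sup>2 / K"
        using S0(3) by (simp only: fun_eq_iff)
      have "(cmod (L2_inner M \<psi> (A \<psi>) - L2_inner M \<psi> (A (?P S))))\<^sup>2 \<le> sqnorm M (rep \<psi>) * (C * ?r)"
        by (rule error[OF S(1,3)])
      also have "\<dots> \<le> K * ?r"
        unfolding K_def by (simp add: distrib_right mult.assoc)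
      also have "\<dots> < \<epsilon>\<^sup>2"
        using r K by (simp add: pos_less_divide_eq mult.commute)
      finally have "cmod (L2_inner M \<psi> (A \<psi>) - L2_inner M \<psi> (A (?P S))) < \<epsilon>"
        using \<epsilon> by (rule_tac power_less_imp_less_base[of _ 2]) auto
      then show "dist (\<Sum>e\<in>S. L2_inner M \<psi> (A e) * L2_inner M e \<psi>) (L2_inner M \<psi> (A \<psi>)) < \<epsilon>"
        unfolding partial[OF S(1,3)] by (simp add: dist_norm norm_minus_commute)
    qed (use S0 in auto)
  qed
qed

text \<open>The bound is the Cauchy-Schwarz inequality for \<open>\<langle>\<psi>, F\<rangle>\<close>.\<close>

lemma rank_one_BH:
  assumes \<psi>: "\<psi> \<in> L2 M"
  shows "rank_one M \<psi> \<in> BH M"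
proof (rule BH_I[where C = "sqnorm M (rep \<psi>) * sqnorm M (rep \<psi>)"])
  note m = L2_measurable_classes[OF \<psi>]
  show "rank_one M \<psi> \<in> L2 M \<rightarrow>\<^sub>E L2 M"
    by (auto simp: rank_one_def L2_closed \<psi>)
  fix F assume F: "F \<in> L2 M"
  show "rank_one M \<psi> (cl_add M F G) = cl_add M (rank_one M \<psi> F) (rank_one M \<psi> G)"
    if G: "G \<in> L2 M" for G
  proof -
    have "L2_inner M \<psi> (cl_add M F G) = fun_inner M (rep \<psi>) (\<lambda>x. rep F x + rep G x)"
      unfolding L2_inner_eq
      by (rule fun_inner_cong_AE)
        (auto intro!: measurable_classes_rep(1) rep_cl_add L2_measurable_classes L2_rep(1) L2_closed
          square_integrable_measurable square_integrable_add \<psi> F G)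
    also have "\<dots> = L2_inner M \<psi> F + L2_inner M \<psi> G"
      unfolding L2_inner_eq by (intro fun_inner_add_right L2_rep(1) \<psi> F G)
    finally have i: "L2_inner M \<psi> (cl_add M F G) = L2_inner M \<psi> F + L2_inner M \<psi> G" .
    have "cl_scale M (L2_inner M \<psi> F + L2_inner M \<psi> G) \<psi> =
        cl_add M (cl_scale M (L2_inner M \<psi> F) \<psi>) (cl_scale M (L2_inner M \<psi> G) \<psi>)"
      unfolding cl_add_def cl_scale_def[of M "L2_inner M \<psi> F + L2_inner M \<psi> G"]
      by (rule ae_class_eqI)
        (use rep_cl_scale(2)[OF m, of "L2_inner M \<psi> F"] rep_cl_scale(2)[OF m, of "L2_inner M \<psi> G"]
          in \<open>eventually_elim, simp add: distrib_right\<close>)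
    with F G i show ?thesis
      by (simp add: rank_one_def L2_closed)
  qed
  show "rank_one M \<psi> (cl_scale M c F) = cl_scale M c (rank_one M \<psi> F)" for c
  proof -
    have "cl_scale M (c * L2_inner M \<psi> F) \<psi> = cl_scale M c (cl_scale M (L2_inner M \<psi> F) \<psi>)"
      unfolding cl_scale_def[of M c] cl_scale_def[of M "c * L2_inner M \<psi> F"]
      by (rule ae_class_eqI)
        (use rep_cl_scale(2)[OF m, of "L2_inner M \<psi> F"] in \<open>eventually_elim, simp\<close>)
    then show ?thesis
      using F by (simp add: rank_one_def L2_closed L2_inner_cl_scale \<psi>)
  qed
  have "sqnorm M (rep (rank_one M \<psi> F)) = sqnorm M (\<lambda>x. L2_inner M \<psi> F * rep \<psi> x)"
    using F by (auto simp: rank_one_def intro!: sqnorm_cong_AE rep_cl_scale(2) measurable_classes_rep(1)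
        borel_measurable_times rep_cl_scale(1) m)
  also have "\<dots> = (cmod (L2_inner M \<psi> F))\<^sup>2 * sqnorm M (rep \<psi>)"
    by (rule sqnorm_scale)
  also have "\<dots> \<le> (sqnorm M (rep \<psi>) * sqnorm M (rep F)) * sqnorm M (rep \<psi>)"
    unfolding L2_inner_eq by (intro mult_right_mono Cauchy_Schwarz_fun_inner L2_rep(1) \<psi> F) simp
  finally show "sqnorm M (rep (rank_one M \<psi> F)) \<le> sqnorm M (rep \<psi>) * sqnorm M (rep \<psi>) * sqnorm M (rep F)"
    by (simp add: mult.assoc mult.left_commute mult.commute)
qed

text \<open>Two operators with the same inner products differ, at each \<open>F\<close>, by a vector orthogonal to all of
  \<open>L\<^sup>2\<close>, in particular to itself; so the description defining \<open>op_adj\<close> is unique.\<close>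

lemma op_adj_eqI:
  assumes A: "\<And>F. F \<in> L2 M \<Longrightarrow> A F \<in> L2 M" and B: "B \<in> BH M"
    and adj: "\<And>F G. F \<in> L2 M \<Longrightarrow> G \<in> L2 M \<Longrightarrow> L2_inner M (B F) G = L2_inner M F (A G)"
  shows "op_adj M A = B"
  unfolding op_adj_def
proof (rule the_equality)
  show "B \<in> BH M \<and> (\<forall>F\<in>L2 M. \<forall>G\<in>L2 M. L2_inner M (B F) G = L2_inner M F (A G))"
    using B adj by blast
  fix B' assume B': "B' \<in> BH M \<and> (\<forall>F\<in>L2 M. \<forall>G\<in>L2 M. L2_inner M (B' F) G = L2_inner M F (A G))"
  show "B' = B"
  proof (rule BH_extensionality)
    fix F assume F: "F \<in> L2 M"
    have L: "B F \<in> L2 M" "B' F \<in> L2 M"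
      using B B' F by (auto intro: BH_closed)
    let ?d = "\<lambda>x. rep (B' F) x - rep (B F) x"
    have d: "square_integrable M ?d"
      by (intro square_integrable_diff L2_rep(1) L)
    note dL = square_integrable_ae_class_L2[OF d]
    have perp: "fun_inner M (rep H) ?d = 0" if "H \<in> L2 M" for H
    proof -
      have "L2_inner M H (B' F) = L2_inner M H (B F)"
        using B' adj[OF F that] F that
        by (simp add: L2_inner_commute[of M H "B' F"] L2_inner_commute[of M H "B F"])
      then show ?thesis
        using that L by (simp add: fun_inner_diff_right L2_rep(1) L2_inner_eq)
    qed
    have "fun_inner M ?d ?d = fun_inner M (rep (ae_class M ?d)) ?d"
      by (rule fun_inner_cong_AE)
        (use rep_ae_class[OF square_integrable_measurable[OF d]] square_integrable_measurable[OF d] in auto)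
    then have "sqnorm M ?d = 0"
      using perp[OF dL] by (simp add: fun_inner_self)
    then have "AE x in M. ?d x = 0"
      by (simp only: sqnorm_eq_0_iff[OF d])
    then have "AE x in M. rep (B' F) x = rep (B F) x"
      by eventually_elim simp
    then show "B' F = B F"
      by (rule class_eqI[OF L2_measurable_classes[OF L(2)] L2_measurable_classes[OF L(1)]])
  qed (use B B' in auto)
qed

lemma restrict_id_BH: "(\<lambda>F\<in>L2 M. F) \<in> BH M"
  by (rule BH_I[where C = 1]) (auto simp: L2_closed)

text \<open>The diagonal entries of \<open>\<langle>\<psi>, \<cdot>\<rangle>\<psi> A\<close> are \<open>\<langle>\<psi>, A e\<rangle> \<langle>e, \<psi>\<rangle>\<close>, the terms of the Parseval
  expansion above: a pure state is the vector state of \<open>\<psi>\<close>.\<close>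

lemma op_trace_rank_one_compose:
  fixes M :: "'a::second_countable_topology measure"
  assumes M: "finite_measure M" "sets M = sets borel" and A: "A \<in> BH M" and \<psi>: "\<psi> \<in> L2 M"
  shows "op_trace M (compose (L2 M) (rank_one M \<psi>) A) = L2_inner M \<psi> (A \<psi>)"
proof -
  define E where "E = (SOME E. onb M E)"
  have E: "onb M E"
    unfolding E_def using onb_exists[OF M] by (rule someI_ex)
  have "L2_inner M e (compose (L2 M) (rank_one M \<psi>) A e) = L2_inner M \<psi> (A e) * L2_inner M e \<psi>"
    if "e \<in> E" for e
  proof -
    have "e \<in> L2 M"
      using that E by (auto simp: onb_def)
    then show ?thesis
      using BH_closed[OF A] \<psi> by (simp add: compose_def rank_one_def L2_inner_cl_scale)
  qed
  then have "op_trace M (compose (L2 M) (rank_one M \<psi>) A) = (\<Sum>\<^sub>\<infinity>e\<in>E. L2_inner M \<psi> (A e) * L2_inner M e \<psi>)"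
    unfolding op_trace_def E_def[symmetric] by (rule infsum_cong)
  also have "\<dots> = L2_inner M \<psi> (A \<psi>)"
    by (rule infsumI[OF Parseval_operator[OF E A \<psi>]])
  finally show ?thesis .
qed

lemma state_of_rank_one:
  fixes M :: "'a::second_countable_topology measure"
  assumes "finite_measure M" "sets M = sets borel" "\<psi> \<in> L2 M"
  shows "state_of_operator M (rank_one M \<psi>) = (\<lambda>A\<in>BH M. L2_inner M \<psi> (A \<psi>))"
  unfolding state_of_operator_def by (rule restrict_ext) (rule op_trace_rank_one_compose[OF assms(1,2) _ assms(3)])

text \<open>A self-adjoint projection \<open>P\<close> is its own absolute value, because \<open>P P = P\<^sup>* P\<close>; its trace is the
  previous lemma with the identity for \<open>A\<close>.\<close>

lemma density_operator_rank_one: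
  fixes M :: "'a::second_countable_topology measure"
  assumes M: "finite_measure M" "sets M = sets borel" and \<psi>: "\<psi> \<in> L2 M" and norm: "L2_inner M \<psi> \<psi> = 1"
  shows "density_operator M (rank_one M \<psi>)"
proof -
  let ?P = "rank_one M \<psi>"
  note BH = rank_one_BH[OF \<psi>]
  have val: "L2_inner M F (?P G) = L2_inner M \<psi> G * L2_inner M F \<psi>" if "F \<in> L2 M" "G \<in> L2 M" for F G
    using that \<psi> by (simp add: rank_one_def L2_inner_cl_scale)
  have adj: "op_adj M ?P = ?P"
  proof (rule op_adj_eqI[OF BH_closed[OF BH] BH])
    fix F G assume FG: "F \<in> L2 M" "G \<in> L2 M"
    then show "L2_inner M (?P F) G = L2_inner M F (?P G)"
      by (simp add: L2_inner_commute[of M "?P F" G] val L2_inner_commute[of M F \<psi>] L2_inner_commute[of M G \<psi>])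
  qed
  have "z * cnj z \<in> \<real>\<^sub>\<ge>\<^sub>0" for z :: complex
    by (simp add: complex_nonneg_Reals_iff complex_mult_cnj)
  then have pos: "op_positive M ?P"
    unfolding op_positive_def
    using BH val by (auto simp: L2_inner_commute[of M _ \<psi>])
  obtain E where E: "onb M E"
    using onb_exists[OF M] by blast
  have "(\<lambda>e. L2_inner M e (?P e)) summable_on E"
  proof -
    have EL: "E \<subseteq> L2 M"
      using E by (auto simp: onb_def)
    have "(\<lambda>e. L2_inner M \<psi> ((\<lambda>F\<in>L2 M. F) e) * L2_inner M e \<psi>) summable_on E"
      using Parseval_operator[OF E restrict_id_BH \<psi>] by (auto simp: summable_on_def)
    then show ?thesis
      by (rule summable_on_cong[THEN iffD1, rotated]) (use EL val in \<open>auto simp: subset_iff\<close>)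
  qed
  then have tc: "?P \<in> trace_class M"
    unfolding trace_class_def using BH pos E adj by auto
  have "compose (L2 M) ?P (\<lambda>F\<in>L2 M. F) = ?P"
    by (auto simp: compose_def rank_one_def fun_eq_iff)
  then have "op_trace M ?P = 1"
    using op_trace_rank_one_compose[OF M restrict_id_BH \<psi>] \<psi> norm by simp
  with tc pos show ?thesis
    by (simp add: density_operator_def)
qed


section \<open>Multiplication operators\<close>

lemma Linf_measurable_classes: "F \<in> Linf M \<Longrightarrow> F \<in> measurable_classes M"
  by (simp add: Linf_iff)

lemma Linf_I:
  assumes "F \<in> measurable_classes M" "AE x in M. cmod (rep F x) \<le> C"
  shows "F \<in> Linf M"
  using assms by (auto simp: Linf_iff)

lemma Linf_closed:
  assumes F: "F \<in> Linf M"
  shows "G \<in> Linf M \<Longrightarrow> cl_add M F G \<in> Linf M" "G \<in> Linf M \<Longrightarrow> cl_mult M F G \<in> Linf M"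
    "cl_scale M c F \<in> Linf M" "cl_cnj M F \<in> Linf M"
proof -
  note m = Linf_measurable_classes[OF F]
  obtain C where C: "AE x in M. cmod (rep F x) \<le> C"
    using F by (auto simp: Linf_iff)
  have "AE x in M. cmod (rep (cl_scale M c F) x) \<le> cmod c * C"
    using C rep_cl_scale(2)[OF m, of c] by eventually_elim (simp add: norm_mult mult_left_mono)
  then show "cl_scale M c F \<in> Linf M"
    by (rule Linf_I[OF rep_cl_scale(1)[OF m]])
  have "AE x in M. cmod (rep (cl_cnj M F) x) \<le> C"
    using C rep_cl_cnj(2)[OF m] by eventually_elim simp
  then show "cl_cnj M F \<in> Linf M"
    by (rule Linf_I[OF rep_cl_cnj(1)[OF m]])
  assume G: "G \<in> Linf M"
  note n = Linf_measurable_classes[OF G]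
  obtain D where D: "AE x in M. cmod (rep G x) \<le> D"
    using G by (auto simp: Linf_iff)
  have "AE x in M. cmod (rep (cl_add M F G) x) \<le> C + D"
    using C D rep_cl_add(2)[OF m n]
    by eventually_elim (metis add_mono norm_triangle_mono)
  then show "cl_add M F G \<in> Linf M"
    by (rule Linf_I[OF rep_cl_add(1)[OF m n]])
  have "AE x in M. cmod (rep (cl_mult M F G) x) \<le> C * D"
    using C D rep_cl_mult(2)[OF m n]
  proof eventually_elim
    case (elim x)
    then show ?case
      using mult_mono[of "cmod (rep F x)" C "cmod (rep G x)" D] order_trans[OF norm_ge_zero elim(1)]
      by (simp add: norm_mult)
  qed
  then show "cl_mult M F G \<in> Linf M"
    by (rule Linf_I[OF rep_cl_mult(1)[OF m n]])
qed

lemma cl_mult_L2: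
  assumes m: "F \<in> measurable_classes M" and C: "AE x in M. cmod (rep F x) \<le> C" and G: "G \<in> L2 M"
  shows "cl_mult M F G \<in> L2 M" "sqnorm M (rep (cl_mult M F G)) \<le> C\<^sup>2 * sqnorm M (rep G)"
proof -
  note n = L2_measurable_classes[OF G]
  have bound: "AE x in M. (cmod (rep (cl_mult M F G) x))\<^sup>2 \<le> C\<^sup>2 * (cmod (rep G x))\<^sup>2"
    using C rep_cl_mult(2)[OF m n]
    by eventually_elim (auto simp: norm_mult power_mult_distrib intro!: mult_right_mono power_mono)
  have int: "integrable M (\<lambda>x. C\<^sup>2 * (cmod (rep G x))\<^sup>2)"
    using L2_rep(1)[OF G] by (simp add: square_integrable_def)
  have sq: "square_integrable M (rep (cl_mult M F G))"
    by (rule square_integrable_bound[OF measurable_classes_rep(1)[OF rep_cl_mult(1)[OF m n]] int bound])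
  then show "cl_mult M F G \<in> L2 M"
    by (simp add: L2_iff rep_cl_mult(1)[OF m n])
  have "sqnorm M (rep (cl_mult M F G)) \<le> (\<integral>x. C\<^sup>2 * (cmod (rep G x))\<^sup>2 \<partial>M)"
    unfolding sqnorm_def using sq int bound by (intro integral_mono_AE) (auto simp: square_integrable_def)
  then show "sqnorm M (rep (cl_mult M F G)) \<le> C\<^sup>2 * sqnorm M (rep G)"
    by (simp add: sqnorm_def)
qed

lemma cl_mult_add_left:
  assumes "F \<in> measurable_classes M" "G \<in> measurable_classes M" "H \<in> measurable_classes M"
  shows "cl_mult M (cl_add M F G) H = cl_add M (cl_mult M F H) (cl_mult M G H)"
  unfolding cl_mult_def[of M "cl_add M F G"] cl_add_def[of M "cl_mult M F H"]
  by (rule ae_class_eqI)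
    (use rep_cl_add(2)[OF assms(1,2)] rep_cl_mult(2)[OF assms(1,3)] rep_cl_mult(2)[OF assms(2,3)]
      in \<open>eventually_elim, simp add: distrib_right\<close>)

lemma cl_mult_scale_left:
  assumes "F \<in> measurable_classes M" "H \<in> measurable_classes M"
  shows "cl_mult M (cl_scale M c F) H = cl_scale M c (cl_mult M F H)"
  unfolding cl_mult_def[of M "cl_scale M c F"] cl_scale_def[of M c "cl_mult M F H"]
  by (rule ae_class_eqI)
    (use rep_cl_scale(2)[OF assms(1), of c] rep_cl_mult(2)[OF assms] in \<open>eventually_elim, simp\<close>)

lemma cl_mult_assoc:
  assumes "F \<in> measurable_classes M" "G \<in> measurable_classes M" "H \<in> measurable_classes M"
  shows "cl_mult M (cl_mult M F G) H = cl_mult M F (cl_mult M G H)"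
  unfolding cl_mult_def[of M "cl_mult M F G"] cl_mult_def[of M F "cl_mult M G H"]
  by (rule ae_class_eqI)
    (use rep_cl_mult(2)[OF assms(1,2)] rep_cl_mult(2)[OF assms(2,3)] in \<open>eventually_elim, simp\<close>)

lemma cl_mult_commute: "cl_mult M F G = cl_mult M G F"
  by (simp add: cl_mult_def mult.commute)

lemma mult_op_BH:
  assumes F: "F \<in> Linf M"
  shows "mult_op M F \<in> BH M"
proof -
  note m = Linf_measurable_classes[OF F]
  obtain C where C: "AE x in M. cmod (rep F x) \<le> C"
    using F by (auto simp: Linf_iff)
  note L = cl_mult_L2[OF m C]
  show ?thesis
  proof (rule BH_I)
    show "mult_op M F \<in> L2 M \<rightarrow>\<^sub>E L2 M"
      by (auto simp: mult_op_def L)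
    fix G assume G: "G \<in> L2 M"
    show "mult_op M F (cl_add M G H) = cl_add M (mult_op M F G) (mult_op M F H)" if H: "H \<in> L2 M" for H
      using cl_mult_add_left[OF L2_measurable_classes[OF G] L2_measurable_classes[OF H] m] G H
      by (simp add: mult_op_def L2_closed cl_mult_commute[of M F])
    show "mult_op M F (cl_scale M c G) = cl_scale M c (mult_op M F G)" for c
      using cl_mult_scale_left[OF L2_measurable_classes[OF G] m] G
      by (simp add: mult_op_def L2_closed cl_mult_commute[of M F])
    show "sqnorm M (rep (mult_op M F G)) \<le> C\<^sup>2 * sqnorm M (rep G)"
      using L(2)[OF G] G by (simp add: mult_op_def)
  qed
qed

text \<open>Complex conjugation moves from one side of the integrand to the other.\<close>

lemma op_adj_mult_op:
  assumes F: "F \<in> Linf M"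
  shows "op_adj M (mult_op M F) = mult_op M (cl_cnj M F)"
proof (rule op_adj_eqI[OF BH_closed[OF mult_op_BH[OF F]] mult_op_BH[OF Linf_closed(4)[OF F]]])
  fix G H assume G: "G \<in> L2 M" and H: "H \<in> L2 M"
  note m = Linf_measurable_classes[OF F]
  note c = rep_cl_cnj(1)[OF m]
  note g = L2_measurable_classes[OF G] and h = L2_measurable_classes[OF H]
  note [measurable] = measurable_classes_rep(1)[OF g] measurable_classes_rep(1)[OF h]
    measurable_classes_rep(1)[OF rep_cl_mult(1)[OF c g]] measurable_classes_rep(1)[OF rep_cl_mult(1)[OF m h]]
  have "L2_inner M (cl_mult M (cl_cnj M F) G) H = L2_inner M G (cl_mult M F H)"
    unfolding L2_inner_def
  proof (rule integral_cong_AE)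
    show "AE x in M. cnj (rep (cl_mult M (cl_cnj M F) G) x) * rep H x = cnj (rep G x) * rep (cl_mult M F H) x"
      using rep_cl_mult(2)[OF c g] rep_cl_mult(2)[OF m h] rep_cl_cnj(2)[OF m] by eventually_elim simp
  qed measurable
  then show "L2_inner M (mult_op M (cl_cnj M F) G) H = L2_inner M G (mult_op M F H)"
    using G H by (simp add: mult_op_def)
qed

lemma star_homomorphism_mult_op: "star_homomorphism M (mult_op M)"
  unfolding star_homomorphism_def
proof (intro conjI ballI allI)
  show "mult_op M \<in> Linf M \<rightarrow> BH M"
    by (auto intro: mult_op_BH)
  fix F assume F: "F \<in> Linf M"
  note f = Linf_measurable_classes[OF F]
  show "mult_op M (cl_scale M c F) = op_scale M c (mult_op M F)" for c
    unfolding mult_op_def op_scale_def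
    by (rule restrict_ext) (simp add: cl_mult_scale_left[OF f] L2_measurable_classes)
  show "mult_op M (cl_cnj M F) = op_adj M (mult_op M F)"
    by (rule op_adj_mult_op[OF F, symmetric])
  fix G assume G: "G \<in> Linf M"
  note g = Linf_measurable_classes[OF G]
  show "mult_op M (cl_add M F G) = op_add M (mult_op M F) (mult_op M G)"
    unfolding mult_op_def op_add_def
    by (rule restrict_ext) (simp add: cl_mult_add_left[OF f g] L2_measurable_classes)
  show "mult_op M (cl_mult M F G) = compose (L2 M) (mult_op M F) (mult_op M G)"
  proof (rule BH_extensionality)
    fix H assume H: "H \<in> L2 M"
    then show "mult_op M (cl_mult M F G) H = compose (L2 M) (mult_op M F) (mult_op M G) H"
      using BH_closed[OF mult_op_BH[OF G] H]
      by (simp add: compose_def mult_op_def cl_mult_assoc[OF f g L2_measurable_classes[OF H]])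
  qed (intro mult_op_BH compose_BH Linf_closed F G)+
qed

text \<open>The constant function \<open>1\<close> is square integrable, and multiplication by \<open>F\<close> sends it to \<open>F\<close>.\<close>

lemma (in finite_measure) inj_on_mult_op: "inj_on (mult_op M) (Linf M)"
proof (rule inj_onI)
  fix F G assume F: "F \<in> Linf M" and G: "G \<in> Linf M" and eq: "mult_op M F = mult_op M G"
  note f = Linf_measurable_classes[OF F] and g = Linf_measurable_classes[OF G]
  have one: "square_integrable M (\<lambda>x. 1)"
    by (rule square_integrable_bounded[where C = 1]) auto
  let ?e = "ae_class M (\<lambda>x. 1) :: 'a fclass"
  have e: "?e \<in> L2 M"
    by (rule square_integrable_ae_class_L2[OF one])
  have re: "AE x in M. rep ?e x = 1"
    by (rule rep_ae_class) simp
  have eq': "cl_mult M F ?e = cl_mult M G ?e"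
    using fun_cong[OF eq, of ?e] e by (simp add: mult_op_def)
  show "F = G"
  proof (rule class_eqI[OF f g])
    show "AE x in M. rep F x = rep G x"
      using re rep_cl_mult(2)[OF f L2_measurable_classes[OF e]]
        rep_cl_mult(2)[OF g L2_measurable_classes[OF e]]
      unfolding eq' by eventually_elim simp
  qed
qed

text \<open>The essential supremum is an extended real; positive total mass keeps it away from \<open>-\<infinity>\<close>, so
  nothing is lost in passing to the real number \<open>Linf_norm\<close>.\<close>

lemma (in prob_space) esssup_Linf:
  assumes F: "F \<in> Linf M"
  shows "esssup M (\<lambda>x. ereal (cmod (rep F x))) = ereal (Linf_norm M F)" "0 \<le> Linf_norm M F"
proof -
  note [measurable] = measurable_classes_rep(1)[OF Linf_measurable_classes[OF F]]
  obtain C where C: "AE x in M. cmod (rep F x) \<le> C"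
    using F by (auto simp: Linf_iff)
  let ?s = "esssup M (\<lambda>x. ereal (cmod (rep F x)))"
  have upper: "?s \<le> ereal C"
    by (rule esssup_I) (use C in auto)
  have "esssup M (\<lambda>x. 0 :: ereal) \<le> ?s"
    by (rule esssup_mono) auto
  then have lower: "0 \<le> ?s"
    using esssup_const[of M "0 :: ereal"] emeasure_space_1 by simp
  from upper lower show "?s = ereal (Linf_norm M F)" "0 \<le> Linf_norm M F"
    unfolding Linf_norm_def by (cases ?s; simp)+
qed

text \<open>For every nonnegative \<open>d\<close> below the essential supremum, \<open>|F|\<close> exceeds \<open>d\<close> on a set \<open>S\<close> of positive measure, and the
  normalized indicator of \<open>S\<close> is stretched by at least \<open>d\<close>.\<close>

lemma (in prob_space) op_norm_mult_op:
  assumes F: "F \<in> Linf M"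
  shows "op_norm M (mult_op M F) = Linf_norm M F"
proof -
  note f = Linf_measurable_classes[OF F]
  note [measurable] = measurable_classes_rep(1)[OF f]
  let ?N = "Linf_norm M F"
  note ess = esssup_Linf[OF F]
  have bound: "AE x in M. cmod (rep F x) \<le> ?N"
    using esssup_AE[of "\<lambda>x. ereal (cmod (rep F x))" M] unfolding ess(1) by simp
  have zero: "ae_class M (\<lambda>x. 0) \<in> L2 M" "L2_norm M (ae_class M (\<lambda>x. 0)) \<le> 1"
  proof -
    show "ae_class M (\<lambda>x. 0) \<in> L2 M"
      by (rule square_integrable_ae_class_L2) simp
    have "sqnorm M (rep (ae_class M (\<lambda>x. 0))) = sqnorm M (\<lambda>x. 0)"
      by (rule sqnorm_cong_AE) (use rep_ae_class[of "\<lambda>x. 0" M] in auto)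
    then show "L2_norm M (ae_class M (\<lambda>x. 0)) \<le> 1"
      by (simp add: L2_norm_eq sqnorm_def)
  qed
  show ?thesis
    unfolding op_norm_def
  proof (rule cSup_eq_non_empty)
    from zero show "{L2_norm M (mult_op M F G) |G. G \<in> L2 M \<and> L2_norm M G \<le> 1} \<noteq> {}"
      by blast
  next
    fix y assume "y \<in> {L2_norm M (mult_op M F G) |G. G \<in> L2 M \<and> L2_norm M G \<le> 1}"
    then obtain G where G: "y = L2_norm M (mult_op M F G)" "G \<in> L2 M" "L2_norm M G \<le> 1"
      by blast
    have "y \<le> sqrt (?N\<^sup>2 * sqnorm M (rep G))"
      using cl_mult_L2(2)[OF f bound G(2)] G(2) by (simp add: G(1) mult_op_def L2_norm_eq)
    also have "\<dots> = ?N * L2_norm M G"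
      using ess(2) by (simp add: real_sqrt_mult L2_norm_eq)
    also have "\<dots> \<le> ?N * 1"
      by (rule mult_left_mono[OF G(3) ess(2)])
    finally show "y \<le> ?N" by simp
  next
    fix y assume y: "\<And>x. x \<in> {L2_norm M (mult_op M F G) |G. G \<in> L2 M \<and> L2_norm M G \<le> 1} \<Longrightarrow> x \<le> y"
    have below: "d \<le> y" if d: "0 \<le> d" "d < ?N" for d
    proof -
      define S where "S = {x \<in> space M. d < cmod (rep F x)}"
      have S[measurable]: "S \<in> sets M"
        unfolding S_def by measurable
      have "emeasure M {x \<in> space M. ereal d < ereal (cmod (rep F x))} > 0"
        by (rule esssup_pos_measure) (use d ess(1) in auto)
      then have pos: "measure M S > 0"
        by (simp add: S_def emeasure_eq_measure)
      define g :: "'a \<Rightarrow> complex" where "g = (\<lambda>x. of_real (1 / sqrt (measure M S)) * indicator S x)"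
      have g: "square_integrable M g"
        unfolding g_def by (intro square_integrable_scale square_integrable_indicator S)
      have gn: "sqnorm M g = 1"
      proof -
        have "(cmod (indicator S x))\<^sup>2 = indicator S x" for x
          by (simp add: indicator_def)
        then have "sqnorm M (indicator S) = measure M S"
          by (simp add: sqnorm_def)
        then show ?thesis
          unfolding g_def sqnorm_scale using pos by (simp add: norm_divide power_divide)
      qed
      define G where "G = ae_class M g"
      have G: "G \<in> L2 M"
        unfolding G_def by (rule square_integrable_ae_class_L2[OF g])
      have rG: "rep G \<in> borel_measurable M" "AE x in M. rep G x = g x"
        unfolding G_def by (rule rep_ae_class[OF square_integrable_measurable[OF g]])+
      have nG: "sqnorm M (rep G) = 1"
        using sqnorm_cong_AE[OF rG(1) square_integrable_measurable[OF g] rG(2)] gn by simp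
      note FG = cl_mult_L2(1)[OF f bound G]
      have "L2_norm M (mult_op M F G) \<le> y"
        by (rule y) (use G nG in \<open>auto simp: L2_norm_eq intro!: exI[of _ G]\<close>)
      moreover have "d \<le> L2_norm M (mult_op M F G)"
      proof -
        have "AE x in M. d\<^sup>2 * (cmod (rep G x))\<^sup>2 \<le> (cmod (rep (cl_mult M F G) x))\<^sup>2"
          using rG(2) rep_cl_mult(2)[OF f L2_measurable_classes[OF G]]
        proof eventually_elim
          case (elim x)
          have "d * cmod (g x) \<le> cmod (rep F x) * cmod (g x)"
            by (cases "x \<in> S") (auto simp: S_def g_def intro!: mult_right_mono)
          then have "(d * cmod (g x))\<^sup>2 \<le> (cmod (rep F x) * cmod (g x))\<^sup>2"
            using d(1) by (intro power_mono) auto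
          then show ?case
            using elim by (simp add: norm_mult power_mult_distrib)
        qed
        then have "(\<integral>x. d\<^sup>2 * (cmod (rep G x))\<^sup>2 \<partial>M) \<le> sqnorm M (rep (cl_mult M F G))"
          unfolding sqnorm_def using L2_rep(1)[OF G] L2_rep(1)[OF FG]
          by (intro integral_mono_AE) (auto simp: square_integrable_def)
        then have "d\<^sup>2 \<le> sqnorm M (rep (cl_mult M F G))"
          using nG by (simp add: sqnorm_def)
        then have "sqrt (d\<^sup>2) \<le> sqrt (sqnorm M (rep (cl_mult M F G)))"
          by (rule real_sqrt_le_mono)
        then show ?thesis
          using d(1) G by (simp add: L2_norm_eq mult_op_def)
      qed
      ultimately show ?thesis by simp
    qed
    \<comment> \<open>If the norm is zero there is no \<open>d\<close> to use, and the zero vector shows that \<open>y\<close> is nonnegative.\<close>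
    show "?N \<le> y"
    proof (cases "?N = 0")
      case True
      have "L2_norm M (mult_op M F (ae_class M (\<lambda>x. 0))) \<le> y"
        by (intro y) (use zero in blast)
      moreover have "0 \<le> L2_norm M (mult_op M F (ae_class M (\<lambda>x. 0)))"
        by (simp add: L2_norm_eq)
      ultimately show ?thesis
        using True by simp
    next
      case False
      then have "0 < ?N" using ess(2) by simp
      then show ?thesis
        using below by (rule dense_le_bounded) simp_all
    qed
  qed
qed


section \<open>Koopman operators of a measure-preserving flow\<close>

locale measure_preserving_flow = prob_space M
  for M :: "'a::second_countable_topology measure" and \<Phi> :: "real \<Rightarrow> 'a \<Rightarrow> 'a" +
  assumes sets_borel: "sets M = sets borel"
    and flow_measurable[measurable]: "\<And>t. \<Phi> t \<in> M \<rightarrow>\<^sub>M M"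
    and flow_distr: "\<And>t. distr M M (\<Phi> t) = M"
    and flow_0: "\<And>x. \<Phi> 0 x = x"
    and flow_add: "\<And>s t x. \<Phi> (s + t) x = \<Phi> s (\<Phi> t x)"
begin

lemma AE_flow: "AE x in M. P x \<Longrightarrow> AE x in M. P (\<Phi> t x)"
  using AE_distrD[OF flow_measurable[of t], of P] unfolding flow_distr .

lemma integral_flow:
  fixes f :: "'a \<Rightarrow> 'b::{banach, second_countable_topology}"
  assumes "f \<in> borel_measurable M"
  shows "(\<integral>x. f (\<Phi> t x) \<partial>M) = (\<integral>x. f x \<partial>M)"
  using integral_distr[OF flow_measurable[of t] assms] by (simp add: flow_distr)

lemma integrable_flow:
  fixes f :: "'a \<Rightarrow> 'b::{banach, second_countable_topology}"
  assumes "integrable M f"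
  shows "integrable M (\<lambda>x. f (\<Phi> t x))"
  using integrable_distr[OF flow_measurable[of t], of f] assms by (simp add: flow_distr)

lemma rep_koopman:
  assumes "F \<in> measurable_classes M"
  shows "koopman M \<Phi> t F \<in> measurable_classes M" "AE x in M. rep (koopman M \<Phi> t F) x = rep F (\<Phi> t x)"
proof -
  note [measurable] = measurable_classes_rep(1)[OF assms]
  show "koopman M \<Phi> t F \<in> measurable_classes M"
    unfolding koopman_def by (rule ae_class_measurable_classes) measurable
  show "AE x in M. rep (koopman M \<Phi> t F) x = rep F (\<Phi> t x)"
    unfolding koopman_def by (rule rep_ae_class) measurable
qed

text \<open>Composition on the right reverses the order of the two times.\<close>

lemma koopman_koopman:
  assumes "F \<in> measurable_classes M"
  shows "koopman M \<Phi> s (koopman M \<Phi> t F) = koopman M \<Phi> (t + s) F"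
  unfolding koopman_def[of M \<Phi> s "koopman M \<Phi> t F"] koopman_def[of M \<Phi> "t + s"]
  by (rule ae_class_eqI) (use AE_flow[OF rep_koopman(2)[OF assms, of t], of s] in \<open>simp add: flow_add\<close>)

lemma koopman_inverse:
  assumes "F \<in> measurable_classes M"
  shows "koopman M \<Phi> t (koopman M \<Phi> (- t) F) = F"
  unfolding koopman_koopman[OF assms]
  by (simp add: koopman_def flow_0 measurable_classes_rep[OF assms])

lemma square_integrable_flow: "square_integrable M f \<Longrightarrow> square_integrable M (\<lambda>x. f (\<Phi> t x))"
  using integrable_flow[of "\<lambda>x. (cmod (f x))\<^sup>2" t]
  by (auto simp: square_integrable_def intro: measurable_compose[OF flow_measurable])

lemma koopman_L2: "F \<in> L2 M \<Longrightarrow> koopman M \<Phi> t F \<in> L2 M"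
  unfolding koopman_def by (intro square_integrable_ae_class_L2 square_integrable_flow L2_rep(1))

lemma koopman_Linf:
  assumes "F \<in> Linf M"
  shows "koopman M \<Phi> t F \<in> Linf M"
proof -
  note f = Linf_measurable_classes[OF assms]
  obtain C where C: "AE x in M. cmod (rep F x) \<le> C"
    using assms by (auto simp: Linf_iff)
  have "AE x in M. cmod (rep (koopman M \<Phi> t F) x) \<le> C"
    using rep_koopman(2)[OF f, of t] AE_flow[OF C, of t] by eventually_elim simp
  then show ?thesis
    by (rule Linf_I[OF rep_koopman(1)[OF f]])
qed

lemma koopman_cl_mult:
  assumes "F \<in> measurable_classes M" "G \<in> measurable_classes M"
  shows "koopman M \<Phi> t (cl_mult M F G) = cl_mult M (koopman M \<Phi> t F) (koopman M \<Phi> t G)"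
  unfolding koopman_def[of M \<Phi> t "cl_mult M F G"] cl_mult_def[of M "koopman M \<Phi> t F"]
  by (rule ae_class_eqI)
    (use AE_flow[OF rep_cl_mult(2)[OF assms], of t] rep_koopman(2)[OF assms(1), of t] rep_koopman(2)[OF assms(2), of t]
      in \<open>eventually_elim, simp\<close>)

lemma L2_inner_koopman:
  assumes "F \<in> L2 M" "G \<in> L2 M"
  shows "L2_inner M (koopman M \<Phi> t F) (koopman M \<Phi> t G) = L2_inner M F G"
proof -
  note f = L2_measurable_classes[OF assms(1)] and g = L2_measurable_classes[OF assms(2)]
  note [measurable] = measurable_classes_rep(1)[OF f] measurable_classes_rep(1)[OF g]
    measurable_classes_rep(1)[OF rep_koopman(1)[OF f, of t]] measurable_classes_rep(1)[OF rep_koopman(1)[OF g, of t]]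
  have "L2_inner M (koopman M \<Phi> t F) (koopman M \<Phi> t G) = (\<integral>x. cnj (rep F (\<Phi> t x)) * rep G (\<Phi> t x) \<partial>M)"
    unfolding L2_inner_def
  proof (rule integral_cong_AE)
    show "AE x in M. cnj (rep (koopman M \<Phi> t F) x) * rep (koopman M \<Phi> t G) x = cnj (rep F (\<Phi> t x)) * rep G (\<Phi> t x)"
      using rep_koopman(2)[OF f, of t] rep_koopman(2)[OF g, of t] by eventually_elim simp
  qed measurable
  also have "\<dots> = L2_inner M F G"
    unfolding L2_inner_def by (rule integral_flow[where f = "\<lambda>x. cnj (rep F x) * rep G x"]) measurable
  finally show ?thesis .
qed

lemma L2_inner_koopman_shift:
  assumes "F \<in> L2 M" "G \<in> L2 M"
  shows "L2_inner M (koopman M \<Phi> (- t) F) G = L2_inner M F (koopman M \<Phi> t G)"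
  using L2_inner_koopman[OF koopman_L2[OF assms(1), of "- t"] assms(2), of t]
  by (simp add: koopman_inverse L2_measurable_classes assms(1))

lemma koopman_op_BH: "koopman_op M \<Phi> t \<in> BH M"
proof (rule BH_I[where C = 1])
  show "koopman_op M \<Phi> t \<in> L2 M \<rightarrow>\<^sub>E L2 M"
    by (auto simp: koopman_op_def koopman_L2)
  fix F assume F: "F \<in> L2 M"
  note f = L2_measurable_classes[OF F]
  show "koopman_op M \<Phi> t (cl_add M F G) = cl_add M (koopman_op M \<Phi> t F) (koopman_op M \<Phi> t G)"
    if G: "G \<in> L2 M" for G
  proof -
    note g = L2_measurable_classes[OF G]
    have "koopman M \<Phi> t (cl_add M F G) = cl_add M (koopman M \<Phi> t F) (koopman M \<Phi> t G)"
      unfolding koopman_def[of M \<Phi> t "cl_add M F G"] cl_add_def[of M "koopman M \<Phi> t F"]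
      by (rule ae_class_eqI)
        (use AE_flow[OF rep_cl_add(2)[OF f g], of t] rep_koopman(2)[OF f, of t] rep_koopman(2)[OF g, of t]
          in \<open>eventually_elim, simp\<close>)
    then show ?thesis
      using F G by (simp add: koopman_op_def L2_closed)
  qed
  show "koopman_op M \<Phi> t (cl_scale M c F) = cl_scale M c (koopman_op M \<Phi> t F)" for c
  proof -
    have "koopman M \<Phi> t (cl_scale M c F) = cl_scale M c (koopman M \<Phi> t F)"
      unfolding koopman_def[of M \<Phi> t "cl_scale M c F"] cl_scale_def[of M c "koopman M \<Phi> t F"]
      by (rule ae_class_eqI)
        (use AE_flow[OF rep_cl_scale(2)[OF f, of c], of t] rep_koopman(2)[OF f, of t] in \<open>eventually_elim, simp\<close>)
    then show ?thesis
      using F by (simp add: koopman_op_def L2_closed)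
  qed
  have "of_real (sqnorm M (rep (koopman M \<Phi> t F))) = (of_real (sqnorm M (rep F)) :: complex)"
    using L2_inner_koopman[OF F F, of t] unfolding L2_inner_eq fun_inner_self .
  then show "sqnorm M (rep (koopman_op M \<Phi> t F)) \<le> 1 * sqnorm M (rep F)"
    using F by (simp add: koopman_op_def)
qed

text \<open>Unitarity of the Koopman operator: invariance of the measure makes it isometric, and time \<open>- t\<close>
  inverts it.\<close>

lemma op_adj_koopman: "op_adj M (koopman_op M \<Phi> t) = koopman_op M \<Phi> (- t)"
proof (rule op_adj_eqI[OF BH_closed[OF koopman_op_BH] koopman_op_BH])
  fix F G assume "F \<in> L2 M" "G \<in> L2 M"
  then show "L2_inner M (koopman_op M \<Phi> (- t) F) G = L2_inner M F (koopman_op M \<Phi> t G)"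
    unfolding koopman_op_def using L2_inner_koopman_shift[of F G t] by simp
qed

lemma koopman_conj_BH: "A \<in> BH M \<Longrightarrow> koopman_conj M \<Phi> t A \<in> BH M"
  unfolding koopman_conj_def op_adj_koopman by (intro compose_BH koopman_op_BH)

lemma koopman_conj_apply:
  assumes "A \<in> BH M" "F \<in> L2 M"
  shows "koopman_conj M \<Phi> t A F = koopman M \<Phi> t (A (koopman M \<Phi> (- t) F))"
  using assms(2) BH_closed[OF assms(1) koopman_L2[OF assms(2), of "- t"]]
  unfolding koopman_conj_def op_adj_koopman by (simp add: compose_def koopman_op_def koopman_L2)

lemma koopman_conj_mult_op:
  assumes F: "F \<in> Linf M"
  shows "koopman_conj M \<Phi> t (mult_op M F) = mult_op M (koopman M \<Phi> t F)"
proof (rule BH_extensionality)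
  fix G assume G: "G \<in> L2 M"
  note f = Linf_measurable_classes[OF F] and g = L2_measurable_classes[OF G]
  show "koopman_conj M \<Phi> t (mult_op M F) G = mult_op M (koopman M \<Phi> t F) G"
    unfolding koopman_conj_apply[OF mult_op_BH[OF F] G]
    using koopman_L2[OF G, of "- t"] G
    by (simp add: mult_op_def koopman_cl_mult[OF f rep_koopman(1)[OF g]] koopman_inverse[OF g])
qed (intro koopman_conj_BH mult_op_BH koopman_Linf F)+

end


section \<open>Square roots of densities and the embedding of states\<close>

lemma csqrt_nonneg_Reals:
  assumes "z \<in> \<real>\<^sub>\<ge>\<^sub>0"
  shows "cnj (csqrt z) * csqrt z = z" "csqrt z = of_real (sqrt (Re z))"
proof -
  obtain r where r: "z = of_real r" "r \<ge> 0"
    using assms by (auto simp: nonneg_Reals_def)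
  then have s: "csqrt z = of_real (sqrt r)"
    by simp
  show "csqrt z = of_real (sqrt (Re z))"
    using s r by simp
  have "cnj (csqrt z) * csqrt z = of_real (sqrt r * sqrt r)"
    unfolding s of_real_mult complex_cnj_complex_of_real ..
  also have "sqrt r * sqrt r = r"
    using r(2) by (rule real_sqrt_mult_self[THEN trans, OF abs_of_nonneg])
  finally show "cnj (csqrt z) * csqrt z = z"
    unfolding r(1) .
qed

text \<open>A density is nonnegative only almost everywhere, and off the nonnegative reals \<open>csqrt\<close> is a branch with
  a cut; replacing it by the real square root of the real part gives a function in the same class that
  is visibly measurable.\<close>

lemma rep_cl_sqrt:
  assumes p: "prob_density M p"
  shows "AE x in M. rep (cl_sqrt M p) x = csqrt (rep p x)" "cl_sqrt M p \<in> L2 M"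
    "AE x in M. cnj (rep (cl_sqrt M p) x) * rep (cl_sqrt M p) x = rep p x"
proof -
  have int: "integrable M (rep p)" and m: "p \<in> measurable_classes M" and pos: "AE x in M. rep p x \<in> \<real>\<^sub>\<ge>\<^sub>0"
    using p by (auto simp: prob_density_def L1_iff)
  note [measurable] = measurable_classes_rep(1)[OF m]
  let ?s = "\<lambda>x. complex_of_real (sqrt (Re (rep p x)))"
  have s: "?s \<in> borel_measurable M"
    by measurable
  have eq: "cl_sqrt M p = ae_class M ?s"
    unfolding cl_sqrt_def
    by (rule ae_class_eqI) (use pos in \<open>eventually_elim, simp add: csqrt_nonneg_Reals(2)\<close>)
  show rep: "AE x in M. rep (cl_sqrt M p) x = csqrt (rep p x)"
    using rep_ae_class(2)[OF s] pos unfolding eq by eventually_elim (simp add: csqrt_nonneg_Reals(2))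
  show "AE x in M. cnj (rep (cl_sqrt M p) x) * rep (cl_sqrt M p) x = rep p x"
    using rep pos by eventually_elim (simp add: csqrt_nonneg_Reals(1))
  have "square_integrable M ?s"
    by (rule square_integrable_bound[OF s, where w = "\<lambda>x. Re (rep p x)"])
      (use int pos in \<open>auto simp: complex_nonneg_Reals_iff\<close>)
  then show "cl_sqrt M p \<in> L2 M"
    unfolding eq by (rule square_integrable_ae_class_L2)
qed

text \<open>Both identities integrate \<open>(\<surd>p)\<^sup>* \<surd>p = p\<close>.\<close>

lemma L2_inner_sqrt_density:
  assumes p: "prob_density M p"
  shows "L2_inner M (cl_sqrt M p) (cl_sqrt M p) = 1"
    and "F \<in> Linf M \<Longrightarrow> L2_inner M (cl_sqrt M p) (mult_op M F (cl_sqrt M p)) = (\<integral>x. rep F x * rep p x \<partial>M)"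
proof -
  let ?s = "cl_sqrt M p"
  have m: "p \<in> measurable_classes M" and tot: "(\<integral>x. rep p x \<partial>M) = 1"
    using p by (auto simp: prob_density_def L1_iff)
  note s = rep_cl_sqrt[OF p]
  note sm = L2_measurable_classes[OF s(2)]
  note [measurable] = measurable_classes_rep(1)[OF m] measurable_classes_rep(1)[OF sm]
  have "(\<integral>x. cnj (rep ?s x) * rep ?s x \<partial>M) = (\<integral>x. rep p x \<partial>M)"
    by (rule integral_cong_AE) (use s(3) in measurable)
  then show "L2_inner M ?s ?s = 1"
    by (simp add: L2_inner_def tot)
  assume F: "F \<in> Linf M"
  note f = Linf_measurable_classes[OF F]
  note [measurable] = measurable_classes_rep(1)[OF f] measurable_classes_rep(1)[OF rep_cl_mult(1)[OF f sm]]
  have "(\<integral>x. cnj (rep ?s x) * rep (cl_mult M F ?s) x \<partial>M) = (\<integral>x. rep F x * rep p x \<partial>M)"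
  proof (rule integral_cong_AE)
    show "AE x in M. cnj (rep ?s x) * rep (cl_mult M F ?s) x = rep F x * rep p x"
      using rep_cl_mult(2)[OF f sm] s(3)
      by eventually_elim (simp add: mult.left_commute)
  qed measurable
  then show "L2_inner M ?s (mult_op M F ?s) = (\<integral>x. rep F x * rep p x \<partial>M)"
    using s(2) by (simp add: L2_inner_def mult_op_def)
qed

context measure_preserving_flow
begin

lemma embed_state_eq:
  assumes "prob_density M p"
  shows "embed_state M (state_of_density M p) =
    (\<lambda>A\<in>BH M. L2_inner M (cl_sqrt M p) (A (cl_sqrt M p)))"
  using embed_state_of_density[OF prob_space_axioms assms]
    state_of_rank_one[OF finite_measure_axioms sets_borel rep_cl_sqrt(2)[OF assms]] by simp

lemma prob_density_koopman:
  assumes p: "prob_density M p"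
  shows "prob_density M (koopman M \<Phi> t p)"
proof -
  have int: "integrable M (rep p)" and m: "p \<in> measurable_classes M" and pos: "AE x in M. rep p x \<in> \<real>\<^sub>\<ge>\<^sub>0"
    and tot: "(\<integral>x. rep p x \<partial>M) = 1"
    using p by (auto simp: prob_density_def L1_iff)
  note k = rep_koopman[OF m, of t]
  note [measurable] = measurable_classes_rep(1)[OF m] measurable_classes_rep(1)[OF k(1)]
  have "integrable M (rep (koopman M \<Phi> t p))"
    using integrable_cong_AE[of "rep (koopman M \<Phi> t p)" M "\<lambda>x. rep p (\<Phi> t x)"] k(2) integrable_flow[OF int, of t]
    by simp
  then have "koopman M \<Phi> t p \<in> L1 M"
    using k(1) by (simp add: L1_iff)
  moreover have "AE x in M. rep (koopman M \<Phi> t p) x \<in> \<real>\<^sub>\<ge>\<^sub>0"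
    using k(2) AE_flow[OF pos, of t] by eventually_elim simp
  moreover have "(\<integral>x. rep (koopman M \<Phi> t p) x \<partial>M) = (\<integral>x. rep p (\<Phi> t x) \<partial>M)"
    by (rule integral_cong_AE) (use k(2) in measurable)
  then have "(\<integral>x. rep (koopman M \<Phi> t p) x \<partial>M) = 1"
    using integral_flow[of "rep p" t] tot by simp
  ultimately show ?thesis
    by (simp add: prob_density_def)
qed

lemma cl_sqrt_koopman:
  assumes p: "prob_density M p"
  shows "cl_sqrt M (koopman M \<Phi> t p) = koopman M \<Phi> t (cl_sqrt M p)"
proof -
  have m: "p \<in> measurable_classes M"
    using p by (simp add: prob_density_def L1_iff)
  show ?thesis
    unfolding cl_sqrt_def[of M "koopman M \<Phi> t p"] koopman_def[of M \<Phi> t "cl_sqrt M p"]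
    by (rule ae_class_eqI)
      (use AE_flow[OF rep_cl_sqrt(1)[OF p], of t] rep_koopman(2)[OF m, of t] in \<open>eventually_elim, simp\<close>)
qed

text \<open>A change of variables along the flow: \<open>\<integral> (F \<circ> \<Phi>\<^sup>t) p = \<integral> F (p \<circ> \<Phi>\<^sup>-\<^sup>t)\<close>.\<close>

lemma transfer_Linf_density:
  assumes p: "prob_density M p"
  shows "transfer_Linf M \<Phi> t (state_of_density M p) = state_of_density M (koopman M \<Phi> (- t) p)"
proof
  fix F
  show "transfer_Linf M \<Phi> t (state_of_density M p) F = state_of_density M (koopman M \<Phi> (- t) p) F"
  proof (cases "F \<in> Linf M")
    case True
    note f = Linf_measurable_classes[OF True]
    have m: "p \<in> measurable_classes M"
      using p by (simp add: prob_density_def L1_iff)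
    note k = rep_koopman[OF m, of "- t"] and kf = rep_koopman[OF f, of t]
    note [measurable] = measurable_classes_rep(1)[OF m] measurable_classes_rep(1)[OF k(1)]
      measurable_classes_rep(1)[OF f] measurable_classes_rep(1)[OF kf(1)]
    have "(\<integral>x. rep F x * rep (koopman M \<Phi> (- t) p) x \<partial>M) =
        (\<integral>x. rep F (\<Phi> t x) * rep (koopman M \<Phi> (- t) p) (\<Phi> t x) \<partial>M)"
      by (rule integral_flow[where f = "\<lambda>x. rep F x * rep (koopman M \<Phi> (- t) p) x", symmetric]) measurable
    also have "\<dots> = (\<integral>x. rep (koopman M \<Phi> t F) x * rep p x \<partial>M)"
    proof (rule integral_cong_AE)
      have inv: "\<Phi> (- t) (\<Phi> t x) = x" for x
        using flow_add[of "- t" t x] by (simp add: flow_0)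
      show "AE x in M. rep F (\<Phi> t x) * rep (koopman M \<Phi> (- t) p) (\<Phi> t x) = rep (koopman M \<Phi> t F) x * rep p x"
        using kf(2) AE_flow[OF k(2), of t] by eventually_elim (simp add: inv)
    qed measurable
    finally show ?thesis
      using True by (simp add: transfer_Linf_def compose_def state_of_density_def koopman_Linf)
  qed (simp add: transfer_Linf_def compose_def state_of_density_def)
qed

text \<open>Unitarity moves \<open>U\<^sup>t\<close> from the observable to the vector \<open>\<surd>p\<close>, and \<open>U\<^sup>-\<^sup>t \<surd>p\<close> is the square root of the
  density \<open>U\<^sup>-\<^sup>t p\<close> of the transported state.\<close>

lemma transfer_embed_state:
  assumes p: "prob_density M p"
  shows "transfer_BH M \<Phi> t (embed_state M (state_of_density M p)) =
    embed_state M (transfer_Linf M \<Phi> t (state_of_density M p))"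
proof -
  note q = prob_density_koopman[OF p, of "- t"] and s = rep_cl_sqrt(2)[OF p]
  have "L2_inner M (cl_sqrt M p) (koopman_conj M \<Phi> t A (cl_sqrt M p)) =
      L2_inner M (koopman M \<Phi> (- t) (cl_sqrt M p)) (A (koopman M \<Phi> (- t) (cl_sqrt M p)))"
    if "A \<in> BH M" for A
    by (simp add: koopman_conj_apply[OF that s] L2_inner_koopman_shift[OF s BH_closed[OF that koopman_L2[OF s]]])
  then show ?thesis
    unfolding transfer_Linf_density[OF p] embed_state_eq[OF p] embed_state_eq[OF q] cl_sqrt_koopman[OF p]
      transfer_BH_def compose_def
    by (intro restrict_ext) (simp add: koopman_conj_BH)
qed

end


section \<open>Consistency of the embedding\<close>

theorem mainTheorem1:
  fixes \<Phi> :: "real \<Rightarrow> 'a::polish_space \<Rightarrow> 'a"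
    and M :: "'a measure"
  assumes "prob_space M" and "sets M = sets borel"
    and "measurable_flow \<Phi>" and "flow_invariant \<Phi> M" and "flow_ergodic \<Phi> M"
  shows
    "(star_homomorphism M (mult_op M) \<and>
      inj_on (mult_op M) (Linf M) \<and>
      (\<forall>F\<in>Linf M. op_norm M (mult_op M F) = Linf_norm M F) \<and>
      (\<forall>t. \<forall>F\<in>Linf M. koopman_conj M \<Phi> t (mult_op M F) = mult_op M (koopman M \<Phi> t F))) \<and>
     embed_state M \<in> normal_states_Linf M \<rightarrow> normal_states_BH M \<and>
     (\<forall>F\<in>Linf M. \<forall>p. prob_density M p \<longrightarrow>
        state_of_density M p F = embed_state M (state_of_density M p) (mult_op M F)) \<and>
     (\<forall>t. \<forall>\<omega>\<in>normal_states_Linf M.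
        transfer_BH M \<Phi> t (embed_state M \<omega>) = embed_state M (transfer_Linf M \<Phi> t \<omega>))"
proof -
  interpret prob_space M by (rule assms(1))
  have joint: "(\<lambda>(t, x). \<Phi> t x) \<in> borel \<Otimes>\<^sub>M borel \<rightarrow>\<^sub>M borel"
    using assms(3) by (simp add: measurable_flow_def)
  interpret measure_preserving_flow M \<Phi>
  proof
    show "sets M = sets borel" by (rule assms(2))
    show "\<Phi> t \<in> M \<rightarrow>\<^sub>M M" for t
      using measurable_Pair2[OF joint, of t]
      by (simp add: measurable_cong_sets[OF assms(2) assms(2)])
  qed (use assms(3,4) in \<open>auto simp: measurable_flow_def flow_invariant_def\<close>)
  have embed: "embed_state M (state_of_density M p) \<in> normal_states_BH M" if p: "prob_density M p" for p
    using embed_state_of_density[OF assms(1) p]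
      density_operator_rank_one[OF finite_measure_axioms sets_borel rep_cl_sqrt(2)[OF p] L2_inner_sqrt_density(1)[OF p]]
    by (auto simp: normal_states_BH_def)
  have expectation: "state_of_density M p F = embed_state M (state_of_density M p) (mult_op M F)"
    if "F \<in> Linf M" "prob_density M p" for F p
    unfolding embed_state_eq[OF that(2)]
    using that by (simp add: mult_op_BH L2_inner_sqrt_density(2) state_of_density_def)
  show ?thesis
    using star_homomorphism_mult_op inj_on_mult_op op_norm_mult_op koopman_conj_mult_op embed expectation
      transfer_embed_state
    by (auto simp: normal_states_Linf_def)
qed

end
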